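(* Consider the equation $$\varphi(|x^{m}-y^{m}|)=|x^{n}-y^{n}|$$ in integers $x,y,m,n$ with $xy\neq 0$, $m>0$, $n>0$, where $\varphi$ is Euler's totient function. Call a solution trivial if it is of the form $(x,y,m,n)=(a\pm 1,a,1,1)$ with $a$ an integer. Then every nontrivial solution is one of $$(x,y,m,n)=\big(2^{t-1}\pm 1,\,-(2^{t-1}\mp 1),\,2,\,1\big)\quad\text{or}\quad (x,y,m,n)=\big(-(2^{t-1}\pm 1),\,2^{t-1}\mp 1,\,2,\,1\big),$$ where $t$ is an integer with $t\geq 2$.
   Context: $\varphi(k)$ denotes Euler's totient function, the number of integers $r$ with $1\le r\le k$ and $\gcd(r,k)=1$.
   Formalization: A solution is additionally required to satisfy x^m ≠ y^m, since φ is a function on positive integers; with φ(0) = 0 the claim would fail, e.g. for x = y = 1, m = n = 1. *)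

theory Defs
  imports "HOL-Number_Theory.Number_Theory"
begin

text \<open>
  Euler's function is a function on the positive integers, so the equation is only meaningful
  when \<open>x ^ m \<noteq> y ^ m\<close>; this is part of being a solution. The library's \<open>totient 0 = 0\<close> would
  otherwise make every \<open>x = y\<close> (and \<open>x = - y\<close> with \<open>m\<close>, \<open>n\<close> even) a spurious solution.
\<close>

definition totient_solution :: "int \<Rightarrow> int \<Rightarrow> nat \<Rightarrow> nat \<Rightarrow> bool" where
  "totient_solution x y m n \<longleftrightarrow>
     x * y \<noteq> 0 \<and> m > 0 \<and> n > 0 \<and> x ^ m \<noteq> y ^ m \<and>
     int (totient (nat \<bar>x ^ m - y ^ m\<bar>)) = \<bar>x ^ n - y ^ n\<bar>"

definition trivial_solution :: "int \<Rightarrow> int \<Rightarrow> nat \<Rightarrow> nat \<Rightarrow> bool" where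
  "trivial_solution x y m n \<longleftrightarrow>
     (\<exists>a. (x, y, m, n) = (a + 1, a, 1, 1) \<or> (x, y, m, n) = (a - 1, a, 1, 1))"

end

theory Submission
  imports Defs "HOL-Analysis.Harmonic_Numbers" "HOL-Analysis.Complex_Transcendental" "HOL-Computational_Algebra.Squarefree"
begin

text \<open>
  After the symmetries $(x,y) \mapsto (y,x)$ and $(x,y) \mapsto (-x,-y)$ we may take
  $x > |y|$. If $m \le n$ the equation forces $\varphi(N) = N$ and the solution is trivial.
  Otherwise divide by $\gcd(x,y)$: the coprime parts $u, v$ satisfy
  $\varphi(u^m - v^m) \mid u^n - v^n$, and parity makes both odd.

  If the power of 2 in $n$ divides $m$, counting factors 2 shows that $u^m - v^m$ is, up to a power
  of 2, a prime power, so that $u^m - v^m \le 3 (u^n - v^n)$; this leaves only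
  $m = 2$, $n = 1$ and $u + v = 2$ with $u - v$ a power of 2.

  If it does not, replace $u, v$ by their $\gcd(m,n)$-th powers, so that $m$ is odd, $n$ is even and
  $m, n$ are coprime. Let $B$ be the set of primes dividing $u^m - v^m$ but not $u - v$. Each of them
  divides $u^m - v^m$ exactly once and is $1$ modulo some prime $q \mid m$, and if $M$ of
  them are $1$ modulo $q$, then $q^M$ divides $u^{q-1} - v^{q-1}$, which gives
  $q^M < u^{(q-1)/2}$. Primitive prime divisors of $u^d - v^d$, for products $d$ of at most three
  primes of $m$, bound the number of primes of $m$ in terms of $M$ for the least $q$. Together
  this yields $\sum_{p \in B} 1/(p-1) \le (\log u)/4$, hence
  $(u^m - v^m)/\varphi(u^m - v^m) \le u$, contradicting $u (u^n - v^n) < u^m - v^m$.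
\<close>

section \<open>Divisors of differences of powers\<close>

text \<open>The quotient of u^j - v^j by u - v, written as a sum so that it can be evaluated modulo
  divisors of u - v.\<close>

definition qsum :: "int \<Rightarrow> int \<Rightarrow> nat \<Rightarrow> int" where
  "qsum u v j = (\<Sum>i<j. v ^ (j - Suc i) * u ^ i)"

lemma qsum_mult: "(u - v) * qsum u v j = u ^ j - v ^ j"
  unfolding qsum_def by (rule power_diff_sumr2[symmetric])

lemma dvd_power_diff_mono:
  fixes u v :: int
  assumes "a dvd b"
  shows "u ^ a - v ^ a dvd u ^ b - v ^ b"
proof -
  obtain c where b: "b = a * c" using assms by blast
  have "u ^ b - v ^ b = (u ^ a - v ^ a) * qsum (u ^ a) (v ^ a) c"
    by (simp add: qsum_mult b power_mult)
  thus ?thesis by simp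
qed

lemma cong_qsum:
  assumes "[u = v] (mod k)"
  shows "[qsum u v j = int j * u ^ (j - 1)] (mod k)"
proof -
  have "[qsum u v j = (\<Sum>i<j. u ^ (j - Suc i) * u ^ i)] (mod k)"
    unfolding qsum_def
    by (intro cong_sum cong_mult cong_pow cong_refl) (use assms cong_sym in blast)
  also have "(\<Sum>i<j. u ^ (j - Suc i) * u ^ i) = (\<Sum>i<j. u ^ (j - 1))"
    by (intro sum.cong refl) (simp flip: power_add)
  finally show ?thesis by simp
qed

text \<open>Modulo a divisor k of u - v all j summands become u^(j-1). So a prime dividing u - v but
  not u can divide the quotient only if it divides j.\<close>

lemma dvd_qsum_iff:
  assumes "k dvd u - v"
  shows "k dvd qsum u v j \<longleftrightarrow> k dvd int j * u ^ (j - 1)"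
proof (rule cong_dvd_iff, rule cong_qsum)
  show "[u = v] (mod k)" using assms by (simp only: cong_iff_dvd_diff)
qed

text \<open>Subtractive Euclidean algorithm on the exponents; v^b can be cancelled because v is
  invertible modulo k.\<close>

lemma dvd_power_diff_gcd:
  fixes k u v :: int
  assumes "coprime k v" "k dvd u ^ a - v ^ a" "k dvd u ^ b - v ^ b"
  shows "k dvd u ^ gcd a b - v ^ gcd a b"
  using assms(2,3)
proof (induction "a + b" arbitrary: a b rule: less_induct)
  case less
  have step: "k dvd u ^ gcd a b - v ^ gcd a b"
    if "0 < b" "b \<le> a" "k dvd u ^ a - v ^ a" "k dvd u ^ b - v ^ b" "x = a + b"
      and IH: "\<And>a b. a + b < x \<Longrightarrow> k dvd u ^ a - v ^ a \<Longrightarrow> k dvd u ^ b - v ^ b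
        \<Longrightarrow> k dvd u ^ gcd a b - v ^ gcd a b"
    for a b x :: nat
  proof -
    have "v ^ b * (u ^ (a - b) - v ^ (a - b)) = (u ^ a - v ^ a) - u ^ (a - b) * (u ^ b - v ^ b)"
      using that(2) by (simp add: algebra_simps flip: power_add)
    hence "k dvd v ^ b * (u ^ (a - b) - v ^ (a - b))"
      using that by (metis dvd_diff dvd_mult)
    hence "k dvd u ^ (a - b) - v ^ (a - b)"
      using assms(1) by (simp add: coprime_dvd_mult_right_iff)
    hence "k dvd u ^ gcd (a - b) b - v ^ gcd (a - b) b"
      using that by (intro IH) auto
    thus ?thesis using that(2) by (simp add: gcd_diff1_nat)
  qed
  consider "a = 0" | "b = 0" | "0 < b" "b \<le> a" | "0 < a" "a \<le> b" by linarith
  thus ?case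
  proof cases
    case 3 thus ?thesis using step[of b a "a + b"] less by blast
  next
    case 4 thus ?thesis using step[of a b "a + b"] less by (metis add.commute gcd.commute)
  qed (use less in auto)
qed

lemma coprime_of_dvd_power_diff:
  fixes k u v :: int
  assumes "coprime u v" "k dvd u ^ a - v ^ a" "0 < a"
  shows "coprime k u" "coprime k v"
proof -
  have *: "is_unit c" if "c dvd u ^ a" "c dvd v ^ a" for c
    using that assms(1) by (meson coprime_common_divisor coprime_power_left_iff coprime_power_right_iff)
  show "coprime k u"
  proof (rule coprimeI)
    fix c assume c: "c dvd k" "c dvd u"
    have "c dvd u ^ a" using c(2) assms(3) by (meson dvd_power dvd_trans)
    moreover have "c dvd u ^ a - v ^ a" using c(1) assms(2) dvd_trans by blast
    ultimately have "c dvd u ^ a - (u ^ a - v ^ a)" by (rule dvd_diff)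
    thus "is_unit c" using * \<open>c dvd u ^ a\<close> by simp
  qed
  show "coprime k v"
  proof (rule coprimeI)
    fix c assume c: "c dvd k" "c dvd v"
    have "c dvd v ^ a" using c(2) assms(3) by (meson dvd_power dvd_trans)
    moreover have "c dvd u ^ a - v ^ a" using c(1) assms(2) dvd_trans by blast
    ultimately show "is_unit c" using * by (metis dvd_add diff_add_cancel)
  qed
qed

lemma prime_dvd_power_diff_fermat:
  fixes u v :: int
  assumes "prime p" "\<not> int p dvd u" "\<not> int p dvd v"
  shows "int p dvd u ^ (p - 1) - v ^ (p - 1)"
proof -
  have *: "[w ^ (p - 1) = 1] (mod int p)" if "\<not> int p dvd w" for w
  proof -
    have "coprime w (int p)"
      using that assms(1) by (metis coprime_commute prime_imp_coprime prime_nat_int_transfer)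
    thus ?thesis
      using residues.euler_theorem[of "int p" w] assms(1) prime_gt_1_nat[OF assms(1)]
      by (simp add: residues_def totient_prime)
  qed
  show ?thesis using *[OF assms(2)] *[OF assms(3)] by (metis cong_iff_dvd_diff cong_sym cong_trans)
qed

text \<open>If q did not divide p - 1, then gcd(q a, p - 1) would divide a, and Fermat together with
  \<open>dvd_power_diff_gcd\<close> would make p divide u^a - v^a.\<close>

lemma prime_dvd_pred_of_dvd_power_diff:
  fixes u v :: int
  assumes "prime p" "prime q" "coprime u v" "0 < a"
    and "int p dvd u ^ (q * a) - v ^ (q * a)" "\<not> int p dvd u ^ a - v ^ a" "\<not> q dvd a"
  shows "q dvd p - 1"
proof (rule ccontr)
  assume q: "\<not> q dvd p - 1"
  have cop: "coprime (int p) u" "coprime (int p) v"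
    using coprime_of_dvd_power_diff[OF assms(3,5)] assms(2,4) by (auto simp: prime_gt_0_nat)
  have "int p dvd u ^ (p - 1) - v ^ (p - 1)"
    using cop assms(1) by (intro prime_dvd_power_diff_fermat)
      (auto simp: coprime_absorb_left prime_nat_iff)
  hence "int p dvd u ^ gcd (q * a) (p - 1) - v ^ gcd (q * a) (p - 1)"
    using cop assms(5) by (intro dvd_power_diff_gcd)
  moreover have "gcd (q * a) (p - 1) dvd a"
  proof -
    have "coprime (gcd (q * a) (p - 1)) q"
      by (metis assms(2) coprime_commute dvd_trans gcd_dvd2 prime_imp_coprime q)
    thus ?thesis using gcd_dvd1[of "q * a" "p - 1"] coprime_dvd_mult_right_iff by blast
  qed
  ultimately show False
    using assms(6) dvd_power_diff_mono dvd_trans by blast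
qed

text \<open>Passing from exponent n to m - 1 does not decrease the difference, and a * b^(m-1)
  exceeds b^m.\<close>

lemma mult_power_diff_less:
  fixes a b :: int
  assumes "0 < b" "b < a" "0 < n" "n < m"
  shows "a * (a ^ n - b ^ n) < a ^ m - b ^ m"
proof -
  obtain j where m: "m = Suc (n + j)" using assms(4) less_imp_Suc_add by blast
  have "b ^ n < a ^ n" using assms by (intro power_strict_mono) auto
  hence "1 * (a ^ n - b ^ n) \<le> a ^ j * (a ^ n - b ^ n)"
    using assms by (intro mult_right_mono one_le_power) auto
  also have "\<dots> \<le> a ^ (n + j) - b ^ (n + j)"
    using assms by (simp add: power_add right_diff_distrib mult.commute mult_left_mono power_mono)
  finally have "a * (a ^ n - b ^ n) \<le> a * (a ^ (n + j) - b ^ (n + j))"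
    using assms by (intro mult_left_mono) auto
  also have "\<dots> = a ^ m - a * b ^ (n + j)" by (simp add: m right_diff_distrib)
  also have "\<dots> < a ^ m - b ^ m" using assms by (simp add: m)
  finally show ?thesis .
qed

section \<open>Sums of reciprocals and totient bounds\<close>

lemma sum_UN_le:
  fixes f :: "'b \<Rightarrow> real"
  assumes "finite I" "\<And>i. i \<in> I \<Longrightarrow> finite (A i)" "\<And>i x. i \<in> I \<Longrightarrow> x \<in> A i \<Longrightarrow> 0 \<le> f x"
  shows "sum f (\<Union>i\<in>I. A i) \<le> (\<Sum>i\<in>I. sum f (A i))"
  using assms
proof (induction I rule: finite_induct)
  case (insert i I)
  have "sum f (A i \<union> (\<Union>i\<in>I. A i)) \<le> sum f (A i) + sum f (\<Union>i\<in>I. A i)"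
    using insert.prems insert.hyps(1) by (subst sum.union_inter[symmetric]) (auto intro!: sum_nonneg)
  thus ?case using insert by fastforce
qed simp

text \<open>The largest of k distinct positive integers is at least k; remove it and induct.\<close>

lemma sum_inverse_le_harm:
  fixes S :: "nat set"
  assumes "finite S" "0 \<notin> S"
  shows "(\<Sum>s\<in>S. 1 / real s) \<le> harm (card S)"
  using assms
proof (induction "card S" arbitrary: S)
  case 0
  thus ?case by (simp add: harm_def)
next
  case (Suc k)
  define M where "M = Max S"
  have M: "M \<in> S" "S \<subseteq> {1..M}" "M > 0"
    using Suc.prems Suc.hyps(2) by (auto simp: M_def Suc_le_eq intro!: Max_in Max_ge gr0I)
      (metis Max_in card.empty nat.distinct(1))+
  have "card S \<le> M" using card_mono[OF _ M(2)] by simp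
  have "(\<Sum>s\<in>S. 1 / real s) = 1 / real M + (\<Sum>s\<in>S - {M}. 1 / real s)"
    using M Suc.prems by (simp add: sum.remove)
  also have "\<dots> \<le> 1 / real (Suc k) + harm k"
    using Suc.hyps(1)[of "S - {M}"] Suc.prems Suc.hyps(2)[symmetric] M \<open>card S \<le> M\<close>
    by (intro add_mono) (auto simp: field_simps)
  finally show ?case using Suc.hyps(2)[symmetric] by (simp add: harm_Suc field_simps)
qed

lemma harm_le_half: "0 < M \<Longrightarrow> (harm M :: real) \<le> (real M + 1) / 2"
proof (induction M rule: nat_induct_non_zero)
  case 1
  thus ?case by (simp add: harm_def)
next
  case (Suc M)
  have "1 / (1 + real M) \<le> 1 / 2" using Suc by (intro divide_left_mono) auto
  moreover have "harm (Suc M) = harm M + 1 / (1 + real M)"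
    by (simp add: harm_Suc inverse_eq_divide)
  moreover have "(real (Suc M) + 1) / 2 = (real M + 1) / 2 + 1 / 2" by (simp add: field_simps)
  ultimately show ?case using Suc.IH by (smt (verit))
qed

text \<open>The constant 9/8 is attained at M = 2. From M = 3 on, one step adds at most 1 + 1/16 to
  the square, by \<open>harm_le_half\<close>.\<close>

lemma harm_square_le: "(harm M)\<^sup>2 \<le> 9 / 8 * real M"
proof -
  have "(harm (M + 3))\<^sup>2 \<le> 9 / 8 * real (M + 3)" for M
  proof (induction M)
    case 0
    thus ?case by (simp add: harm_def numeral_eq_Suc power2_eq_square)
  next
    case (Suc M)
    define h x where "h = (harm (M + 3) :: real)" and "x = real (M + 4)"
    have x: "x \<ge> 4" by (simp add: x_def)
    have "h \<le> x / 2" using harm_le_half[of "M + 3"] by (simp add: h_def x_def field_simps)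
    have "(harm (Suc M + 3))\<^sup>2 = (h + 1 / x)\<^sup>2"
      using harm_Suc[of "M + 3", where 'a = real]
      by (simp add: h_def x_def inverse_eq_divide add_ac del: harm_Suc)
    also have "\<dots> = h\<^sup>2 + 2 * h / x + 1 / x\<^sup>2" using x by (simp add: power2_eq_square field_simps)
    also have "2 * h / x \<le> 1" using x \<open>h \<le> x / 2\<close> by (simp add: field_simps)
    also have "1 / x\<^sup>2 \<le> 1 / 4\<^sup>2" using x by (intro divide_left_mono power_mono) auto
    also have "h\<^sup>2 \<le> 9 / 8 * (x - 1)" using Suc by (simp add: h_def x_def)
    finally have "(harm (Suc M + 3))\<^sup>2 \<le> 9 / 8 * x" by (simp add: field_simps)
    thus ?case by (simp add: x_def add_ac)
  qed
  from this[of "M - 3"] have "M \<ge> 3 \<Longrightarrow> ?thesis" by simp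
  moreover have "M = 0 \<or> M = 1 \<or> M = 2 \<or> M \<ge> 3" by linarith
  ultimately show ?thesis by (auto simp: harm_def numeral_eq_Suc power2_eq_square)
qed

text \<open>Divided by the full product, the sum becomes the sum of the reciprocals 1/q. These are
  at most three distinct numbers, each at most 1/3, so they add up to less than 1.\<close>

lemma sum_prod_remove_less_prod:
  fixes I :: "nat set"
  assumes "finite I" "card I \<le> 3" "\<And>q. q \<in> I \<Longrightarrow> 3 \<le> q" "I \<noteq> {}"
  shows "(\<Sum>q\<in>I. \<Prod>(I - {q})) < \<Prod>I"
proof -
  have "(\<Sum>q\<in>I. 1 / real q) < 1"
  proof (cases "I \<subseteq> {3}")
    case True
    thus ?thesis using assms(4) by (auto simp: subset_singleton_iff)
  next
    case False
    then obtain r where "r \<in> I" "r \<noteq> 3" by auto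
    hence "1 / real r < 1 / 3" using assms(3)[of r] by (intro divide_strict_left_mono) auto
    moreover have "1 / real q \<le> 1 / 3" if "q \<in> I" for q
      using assms(3)[OF that] by (intro divide_left_mono) auto
    ultimately have "(\<Sum>q\<in>I. 1 / real q) < (\<Sum>q\<in>I. 1 / 3)"
      using assms(1) \<open>r \<in> I\<close> by (intro sum_strict_mono_ex1) auto
    thus ?thesis using assms(2) by simp
  qed
  moreover have pos: "0 < \<Prod>I" using assms(3) by (intro prod_pos) force
  ultimately have "real (\<Prod>I) * (\<Sum>q\<in>I. 1 / real q) < real (\<Prod>I)"
    using mult_strict_left_mono[of "\<Sum>q\<in>I. 1 / real q" 1 "real (\<Prod>I)"]
    by (simp only: of_nat_0_less_iff mult_1_right)
  also have "real (\<Prod>I) * (\<Sum>q\<in>I. 1 / real q) = (\<Sum>q\<in>I. real (\<Prod>(I - {q})))"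
    unfolding sum_distrib_left
  proof (intro sum.cong refl)
    fix q assume "q \<in> I"
    hence "\<Prod>I = q * \<Prod>(I - {q})" using assms(1) by (simp add: prod.remove)
    moreover have "q > 0" using assms(3)[OF \<open>q \<in> I\<close>] by simp
    ultimately show "real (\<Prod>I) * (1 / real q) = real (\<Prod>(I - {q}))" by simp
  qed
  also have "\<dots> = real (\<Sum>q\<in>I. \<Prod>(I - {q}))" by (rule of_nat_sum[symmetric])
  finally show ?thesis by (simp only: of_nat_less_iff)
qed

lemma prod_primes_dvd:
  fixes N :: nat
  assumes "finite S" "\<And>p. p \<in> S \<Longrightarrow> prime p" "\<And>p. p \<in> S \<Longrightarrow> p dvd N"
  shows "\<Prod>S dvd N"
  using assms
proof (induction S rule: finite_induct)
  case (insert p S)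
  have "coprime p (\<Prod>S)"
    using insert by (intro prod_coprime_right primes_coprime) auto
  thus ?case using insert by (auto intro: divides_mult)
qed simp

lemma card_subsets_with_le_3:
  assumes "finite P" "q \<in> P"
  shows "card {I. I \<subseteq> P \<and> q \<in> I \<and> card I \<le> 3} =
    1 + (card P - 1) + ((card P - 1) choose 2)"
proof -
  define Q where "Q = P - {q}"
  have Q: "finite Q" "q \<notin> Q" "P = insert q Q" "card Q = card P - 1"
    using assms by (auto simp: Q_def)
  have "{I. I \<subseteq> P \<and> q \<in> I \<and> card I \<le> 3} = insert q ` {J. J \<subseteq> Q \<and> card J \<le> 2}"
  proof safe
    fix I assume I: "I \<subseteq> P" "q \<in> I" "card I \<le> 3"
    hence "finite I" using assms(1) finite_subset by blast
    hence "card (I - {q}) \<le> 2" "I - {q} \<subseteq> Q" "I = insert q (I - {q})"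
      using I by (auto simp: Q_def)
    thus "I \<in> insert q ` {J. J \<subseteq> Q \<and> card J \<le> 2}" by blast
  next
    fix J assume J: "J \<subseteq> Q" "card J \<le> 2"
    hence "finite J" "q \<notin> J" using Q finite_subset by blast+
    thus "card (insert q J) \<le> 3" using J by simp
  qed (use Q in auto)
  moreover have "inj_on (insert q) {J. J \<subseteq> Q \<and> card J \<le> 2}"
    using Q(2) by (intro inj_onI) (metis (no_types, lifting) insert_ident mem_Collect_eq subsetD)
  ultimately have "card {I. I \<subseteq> P \<and> q \<in> I \<and> card I \<le> 3} = card {J. J \<subseteq> Q \<and> card J \<le> 2}"
    by (simp add: card_image)
  also have "{J. J \<subseteq> Q \<and> card J \<le> 2} = (\<Union>i\<in>{..2}. {J. J \<subseteq> Q \<and> card J = i})" by auto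
  also have "card \<dots> = (\<Sum>i\<le>2. card {J. J \<subseteq> Q \<and> card J = i})"
    using Q(1) by (intro card_UN_disjoint) auto
  also have "\<dots> = (\<Sum>i\<le>2. card Q choose i)" using Q(1) by (simp add: n_subsets)
  finally show ?thesis by (simp add: Q(4) numeral_2_eq_2)
qed

text \<open>Prime by prime: p <= (p - 1)^2 for p >= 3, and the remaining power of p only grows on
  squaring.\<close>

lemma odd_le_totient_square:
  assumes "odd w"
  shows "w \<le> (totient w)\<^sup>2"
proof -
  have w: "w > 0" using assms by (rule odd_pos)
  have "w = (\<Prod>p\<in>prime_factors w. p ^ multiplicity p w)"
    using w by (intro prime_factorization_nat) auto
  also have "\<dots> \<le> (\<Prod>p\<in>prime_factors w. (p ^ (multiplicity p w - 1) * (p - 1))\<^sup>2)"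
  proof (intro prod_mono conjI)
    fix p assume p: "p \<in> prime_factors w"
    hence "p dvd w" "prime p" by auto
    hence "odd p" using assms dvd_trans by blast
    hence "p \<noteq> 2" by auto
    hence "p \<ge> 3" using prime_ge_2_nat[OF \<open>prime p\<close>] by linarith
    have "multiplicity p w > 0" using p by (simp add: prime_factors_multiplicity)
    then obtain j where j: "multiplicity p w = Suc j" by (auto dest: gr0_implies_Suc)
    obtain r where r: "p = r + 3" using \<open>p \<ge> 3\<close> by (metis le_add_diff_inverse2)
    have "p \<le> (p - 1)\<^sup>2" by (simp add: r power2_eq_square algebra_simps)
    moreover have "p ^ j \<le> (p ^ j)\<^sup>2" using r by (simp add: power2_eq_square)
    ultimately have "p ^ j * p \<le> (p ^ j)\<^sup>2 * (p - 1)\<^sup>2" by (rule mult_le_mono[rotated])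
    thus "p ^ multiplicity p w \<le> (p ^ (multiplicity p w - 1) * (p - 1))\<^sup>2"
      by (simp add: j power_mult_distrib mult.commute)
  qed simp
  also have "\<dots> = (totient w)\<^sup>2" by (simp add: totient_formula1[OF w] prod_power_distrib)
  finally show ?thesis .
qed

lemma ln_ge_of_power_le:
  fixes x :: real
  assumes "0 < x" "(272 / 100) ^ a \<le> x ^ b" "0 < b"
  shows "real a / real b \<le> ln x"
proof -
  have "exp (real a) = exp 1 ^ a" by (simp flip: exp_of_nat_mult)
  also have "\<dots> \<le> (272 / 100) ^ a" using e_less_272 by (intro power_mono) auto
  also have "\<dots> \<le> x ^ b" by fact
  finally have "real a \<le> ln (x ^ b)" using assms by (simp add: ln_ge_iff)
  thus ?thesis using assms by (simp add: ln_realpow field_simps)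
qed

text \<open>The ratio 18/7 is what the last estimate in \<open>sum_B_le\<close> requires. The
  rational 1604/1000 lies just above sqrt(18/7) and below both 45/28, the bound proved for q = 3,
  and 13/8, the bound proved for q >= 5.\<close>

lemma odd_ln_bound:
  fixes q :: nat
  assumes "odd q" "3 \<le> q"
  shows "18 * (real q - 1)\<^sup>2 \<le> 7 * (real q * ln (real q))\<^sup>2"
proof -
  have "13 * (real q - 1) \<le> 8 * (real q * ln (real q))" if "q \<ge> 5"
  proof -
    have "q \<noteq> 6" using assms(1) by auto
    hence "q = 5 \<or> q \<ge> 7" using that by linarith
    then consider "q = 5" | "q \<ge> 7" by blast
    thus ?thesis
    proof cases
      case 1
      have "real 3 / real 2 \<le> ln 5" by (rule ln_ge_of_power_le) (simp_all add: power_divide)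
      thus ?thesis using 1 by simp
    next
      case 2
      have "real 13 / real 8 \<le> ln 7" by (rule ln_ge_of_power_le) (simp_all add: power_divide)
      also have "\<dots> \<le> ln (real q)" using 2 by simp
      finally have "real q * (13 / 8) \<le> real q * ln (real q)" by (intro mult_left_mono) auto
      thus ?thesis by simp
    qed
  qed
  moreover have "45 * (real q - 1) \<le> 28 * (real q * ln (real q))" if "q = 3"
  proof -
    have "real 15 / real 14 \<le> ln 3" by (rule ln_ge_of_power_le) (simp_all add: power_divide)
    thus ?thesis using that by simp
  qed
  moreover have "q = 3 \<or> q \<ge> 5" using assms by (cases "q = 4") auto
  ultimately have "45 * (real q - 1) \<le> 28 * (real q * ln (real q)) \<or> 13 * (real q - 1) \<le> 8 * (real q * ln (real q))"
    by blast
  hence "\<bar>1604 / 1000 * (real q - 1)\<bar> \<le> \<bar>real q * ln (real q)\<bar>" using assms(2) by auto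
  hence "(1604 / 1000 * (real q - 1))\<^sup>2 \<le> (real q * ln (real q))\<^sup>2"
    by (simp only: abs_le_square_iff)
  hence "(1604 / 1000)\<^sup>2 * (real q - 1)\<^sup>2 \<le> (real q * ln (real q))\<^sup>2"
    by (simp only: power_mult_distrib)
  moreover have "18 / 7 * (real q - 1)\<^sup>2 \<le> (1604 / 1000)\<^sup>2 * (real q - 1)\<^sup>2"
    by (intro mult_right_mono) (auto simp: power2_eq_square)
  ultimately have "18 / 7 * (real q - 1)\<^sup>2 \<le> (real q * ln (real q))\<^sup>2" by (rule order_trans[rotated])
  thus ?thesis by simp
qed

lemma squarefree_dvdI:
  fixes a b :: int
  assumes "squarefree a" "b \<noteq> 0" "\<And>p. prime p \<Longrightarrow> p dvd a \<Longrightarrow> p dvd b"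
  shows "a dvd b"
proof (rule multiplicity_le_imp_dvd)
  show "a \<noteq> 0" using assms(1) by auto
  fix p :: int assume p: "prime p"
  show "multiplicity p a \<le> multiplicity p b"
  proof (cases "p dvd a")
    case True
    have "multiplicity p a \<le> 1"
      using assms(1) p \<open>a \<noteq> 0\<close> squarefree_factorial_semiring''[of a] by blast
    also have "1 \<le> multiplicity p b"
      using assms(2) assms(3)[OF p True] p by (intro multiplicity_geI) auto
    finally show ?thesis .
  qed (simp add: not_dvd_imp_multiplicity_0)
qed

section \<open>Coprime odd bases\<close>

locale odd_pair =
  fixes u v :: int
  assumes cop: "coprime u v" and odd_u: "odd u" and odd_v: "odd v" and less: "\<bar>v\<bar> < u"
begin

lemma u_ge: "u \<ge> 3"
proof -
  have "v \<noteq> 0" using odd_v by auto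
  moreover have "u \<noteq> 2" using odd_u by auto
  ultimately show ?thesis using less by linarith
qed

lemma v_ne: "v \<noteq> 0" using odd_v by auto

lemma diff_ge: "u - v \<ge> 2" "v < 0 \<Longrightarrow> u - v \<ge> 4" "even (u - v)"
proof -
  show "even (u - v)" using odd_u odd_v by simp
  thus "u - v \<ge> 2" using less by presburger
qed (use u_ge in linarith)

lemma abs_power_less: "0 < j \<Longrightarrow> \<bar>v ^ j\<bar> < u ^ j"
  using power_strict_mono[OF less, of j] by (simp add: power_abs)

lemma power_diff_pos: "0 < j \<Longrightarrow> 0 < u ^ j - v ^ j"
  using abs_power_less[of j] by linarith

text \<open>Multiplied by u - v the claim becomes 2 v^j < u^j + v u^(j-1). For v < 0 the left side
  is negative since j is odd, and the right side is u^(j-1) (u + v) > 0.\<close>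

lemma qsum_lower:
  assumes "odd j"
  shows "u ^ (j - 1) < 2 * qsum u v j"
proof -
  obtain i where j: "j = Suc i" using assms by (cases j) auto
  have i: "even i" using assms j by simp
  have "2 * v ^ j < u ^ j + v * u ^ i"
  proof (cases "v < 0")
    case True
    have "v ^ j < 0" using True assms by (simp add: power_less_zero_eq)
    moreover have "0 < u ^ i * (u + v)" using u_ge less by simp
    ultimately show ?thesis by (simp add: j algebra_simps)
  next
    case False
    hence "v ^ j < u ^ j" "v * v ^ i \<le> v * u ^ i"
      using abs_power_less[of j] less j by (auto intro!: mult_left_mono power_mono)
    thus ?thesis by (simp add: j)
  qed
  hence "u ^ i * (u - v) < 2 * (u ^ j - v ^ j)" by (simp add: j algebra_simps)
  also have "\<dots> = 2 * qsum u v j * (u - v)" by (simp flip: qsum_mult)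
  finally show ?thesis using diff_ge(1) by (simp add: j)
qed

lemma qsum_pos: "odd j \<Longrightarrow> 0 < qsum u v j"
  using qsum_lower[of j] u_ge by (smt (verit) zero_le_power)

text \<open>Compare after multiplication by u - v. For v > 0 the bound u - v >= 2 suffices; for v <
  0 the difference u^j - v^j may exceed u^j but stays below 2 u^j, and then u - v >= 4.\<close>

lemma qsum_upper:
  assumes "0 < j"
  shows "2 * qsum u v j < u ^ j"
proof -
  have pos: "0 < u ^ j" using u_ge by simp
  have "2 * (u ^ j - v ^ j) < u ^ j * (u - v)"
  proof (cases "v < 0")
    case True
    have "4 * u ^ j \<le> (u - v) * u ^ j" using diff_ge(2)[OF True] pos by (intro mult_right_mono) auto
    moreover have "- (v ^ j) < u ^ j" using abs_power_less[OF assms] by (simp only: abs_less_iff)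
    ultimately show ?thesis by (smt (verit) mult.commute)
  next
    case False
    hence "v ^ j > 0" using v_ne by simp
    moreover have "2 * u ^ j \<le> (u - v) * u ^ j" using diff_ge(1) pos by (intro mult_right_mono) auto
    ultimately show ?thesis by (simp add: mult.commute)
  qed
  also have "2 * (u ^ j - v ^ j) = 2 * qsum u v j * (u - v)" by (simp flip: qsum_mult)
  finally show ?thesis using diff_ge(1) by simp
qed

lemma qsum_dvd_mono:
  assumes "j dvd k"
  shows "qsum u v j dvd qsum u v k"
proof -
  have "(u - v) * qsum u v j dvd (u - v) * qsum u v k"
    unfolding qsum_mult by (rule dvd_power_diff_mono[OF assms])
  thus ?thesis using diff_ge(1) by simp
qed

lemma prime_not_dvd_u:
  assumes "prime p" "int p dvd u ^ j - v ^ j" "0 < j"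
  shows "\<not> int p dvd u" "\<not> int p dvd v"
  using coprime_of_dvd_power_diff[OF cop assms(2,3)] assms(1)
  by (auto simp: coprime_absorb_left prime_nat_iff)

lemma qsum_prime_gt:
  assumes "prime q" "odd q"
  shows "int q < qsum u v q"
proof -
  have *: "int (2 * (k + 3)) < 3 ^ (k + 2)" for k by (induction k) auto
  have "q \<noteq> 2" using assms(2) by auto
  hence q: "q \<ge> 3" using prime_ge_2_nat[OF assms(1)] by linarith
  have "int (2 * q) < 3 ^ (q - 1)"
    using *[of "q - 3"] q by (simp add: numeral_eq_Suc Suc_diff_Suc)
  also have "\<dots> \<le> u ^ (q - 1)" using u_ge by (intro power_mono) auto
  also have "\<dots> < 2 * qsum u v q" by (rule qsum_lower[OF assms(2)])
  finally show ?thesis by simp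
qed

text \<open>The bound u^(3/4) for W / phi(W) leaves u^(1/4) for the remaining primes of u^m - v^m.
  The power of 2 contributes the factor 16 = 2^4. For the odd part w, where w + 2 <= u,
  \<open>odd_le_totient_square\<close> is enough from w = 9 on; smaller w are checked
  directly.\<close>

lemma diff_totient_bound:
  defines "W \<equiv> nat (u - v)"
  shows "int (W ^ 4) \<le> int (totient W ^ 4) * u ^ 3"
proof -
  have W: "W > 0" using diff_ge(1) by (simp add: W_def)
  obtain a w where aw: "W = 2 ^ a * w" "odd w"
    using W by (metis multiplicity_decompose' not_is_unit_0 two_is_prime_nat prime_nat_iff nat_dvd_1_iff_1 less_not_refl numeral_eq_one_iff semiring_norm(85))
  have "even W" using diff_ge by (simp add: W_def even_nat_iff)
  then obtain b where b: "a = Suc b" using aw by (cases a) auto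
  have tW: "totient W = 2 ^ b * totient w"
    using aw b by (simp add: totient_mult_coprime totient_prime_power_Suc del: power_Suc)
  have "int W < 2 * u" using less diff_ge(1) by (simp add: W_def)
  moreover have "2 * w \<le> W" by (simp add: aw b)
  ultimately have "int w < u" by linarith
  moreover have "odd (int w)" using aw(2) by simp
  ultimately have wu: "int w + 2 \<le> u" using odd_u by presburger
  have key: "16 * int w ^ 4 \<le> int (totient w) ^ 4 * u ^ 3"
  proof -
    have u3: "x ^ 3 \<le> u ^ 3" if "0 \<le> x" "x \<le> u" for x using that by (intro power_mono)
    have p: "prime (3::nat)" "prime (5::nat)" "prime (7::nat)" by simp_all
    have "w = 1 \<or> w = 3 \<or> w = 5 \<or> w = 7 \<or> w \<ge> 9" using aw(2) by presburger
    then consider "w = 1" | "w = 3" | "w = 5" | "w = 7" | "w \<ge> 9" by blast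
    thus ?thesis
    proof cases
      case 1 thus ?thesis using u3[of 3] u_ge by simp
    next
      case 2 thus ?thesis using u3[of 5] wu totient_prime[OF p(1)] by simp
    next
      case 3 thus ?thesis using u3[of 7] wu totient_prime[OF p(2)] by simp
    next
      case 4 thus ?thesis using u3[of 9] wu totient_prime[OF p(3)] by simp
    next
      case 5
      define x where "x = int w"
      have x: "x \<ge> 9" using 5 by (simp add: x_def)
      have "x \<le> int (totient w) ^ 2"
        using odd_le_totient_square[OF aw(2)] unfolding x_def by (metis of_nat_le_iff of_nat_power)
      hence t: "x ^ 2 \<le> int (totient w) ^ 4"
        using power_mono[of x "int (totient w) ^ 2" 2] x by simp
      \<comment> \<open>Nearly tight at x = 9 (1296 against 1331), which is checked separately; from
        x = 10 on the cubic term covers 10 x^2.\<close>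
      have "16 * x ^ 2 \<le> (x + 2) ^ 3"
      proof (cases "x = 9")
        case False
        hence "10 * x ^ 2 \<le> x * x ^ 2" using x by (intro mult_right_mono) auto
        also have "\<dots> \<le> (x + 2) ^ 3 - 6 * x ^ 2"
          using x by (simp add: power2_eq_square power3_eq_cube algebra_simps)
        finally show ?thesis by simp
      qed simp
      also have "\<dots> \<le> u ^ 3" using wu x by (intro u3) (auto simp: x_def)
      finally have "x ^ 2 * (16 * x ^ 2) \<le> int (totient w) ^ 4 * u ^ 3"
        using t by (intro mult_mono) auto
      thus ?thesis by (simp add: x_def power4_eq_xxxx power2_eq_square)
    qed
  qed
  have "int (W ^ 4) = (2 ^ b) ^ 4 * (16 * int w ^ 4)"
    by (simp add: aw b power_mult_distrib)
  also have "\<dots> \<le> (2 ^ b) ^ 4 * (int (totient w) ^ 4 * u ^ 3)" using key by (intro mult_left_mono) auto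
  also have "\<dots> = int (totient W ^ 4) * u ^ 3" by (simp add: tW power_mult_distrib)
  finally show ?thesis .
qed

end

section \<open>Odd m and even n\<close>

text \<open>The equation enters as a divisibility, the form in which it passes to the coprime parts
  of x and y. No instance exists, by \<open>inconsistent\<close>.\<close>

locale residual_case = odd_pair +
  fixes m n :: nat
  assumes odd_m: "odd m" and even_n: "even n" and cop_mn: "coprime m n"
    and n_pos: "0 < n" and n_less: "n < m"
    and totient_dvd_diff: "int (totient (nat (u ^ m - v ^ m))) dvd u ^ n - v ^ n"
begin

lemma m_pos: "0 < m" using odd_m by (cases m) auto

lemma dvd_totient_imp_dvd:
  assumes "k dvd totient (nat (u ^ m - v ^ m))"
  shows "int k dvd u ^ n - v ^ n"
  using assms totient_dvd_diff by (meson dvd_trans of_nat_dvd_iff)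

lemma dvd_both_imp_dvd_diff:
  assumes "k dvd u ^ m - v ^ m" "k dvd u ^ n - v ^ n"
  shows "k dvd u - v"
  using dvd_power_diff_gcd[OF coprime_of_dvd_power_diff(2)[OF cop assms(1) m_pos] assms] cop_mn
  by simp

definition B :: "nat set" where
  "B = {p. prime p \<and> int p dvd u ^ m - v ^ m \<and> \<not> int p dvd u - v}"

lemma dvd_N_iff: "k dvd nat (u ^ m - v ^ m) \<longleftrightarrow> int k dvd u ^ m - v ^ m"
  using power_diff_pos[OF m_pos] by (simp add: nat_dvd_iff flip: int_dvd_int_iff)

lemma finite_B: "finite B"
proof (rule finite_subset)
  show "B \<subseteq> {..nat (u ^ m - v ^ m)}"
    using power_diff_pos[OF m_pos] by (auto simp: B_def simp flip: dvd_N_iff intro!: dvd_imp_le)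
qed simp

text \<open>A square p^2 would put p into the totient, hence into u^n - v^n, and then into u - v by
  \<open>dvd_both_imp_dvd_diff\<close>.\<close>

lemma B_exact:
  assumes "p \<in> B"
  shows "\<not> (int p)\<^sup>2 dvd u ^ m - v ^ m"
proof
  assume "(int p)\<^sup>2 dvd u ^ m - v ^ m"
  hence "p\<^sup>2 dvd nat (u ^ m - v ^ m)" by (simp add: dvd_N_iff)
  from Totient.totient_dvd[OF this] have "p dvd totient (nat (u ^ m - v ^ m))"
    using assms totient_prime_power_Suc[of p 1] by (auto simp: B_def numeral_2_eq_2 dest: dvd_mult_left)
  from dvd_totient_imp_dvd[OF this] assms dvd_both_imp_dvd_diff show False by (auto simp: B_def)
qed

lemma B_odd:
  assumes "p \<in> B"
  shows "odd p"
proof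
  assume "even p"
  hence "p = 2" using assms primes_dvd_imp_eq[OF two_is_prime_nat, of p] by (simp add: B_def)
  hence "\<not> 2 dvd u - v" using assms by (auto simp: B_def)
  thus False using diff_ge(3) by contradiction
qed

text \<open>
  If $q \mid u - v$, then $u^m - v^m$ contains one more factor $q$ than $u - v$, while
  $u^n - v^n$ contains as many as $u - v$. The missing factor $q$ of the totient comes from
  a prime $p \equiv 1$ modulo $q$ dividing $(u^q - v^q)/(u - v)$ or, if this quotient
  is a power of $q$, from its exponent being at least 2.
\<close>

lemma not_dvd_diff:
  assumes q: "prime q" "q dvd m"
  shows "\<not> int q dvd u - v"
proof
  assume qW: "int q dvd u - v"
  have "odd q" using q(2) odd_m by auto
  define c where "c = multiplicity (int q) (u - v)"
  have pq: "prime (int q)" using q by simp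
  have W0: "u - v \<noteq> 0" using diff_ge by simp
  have c: "int q ^ c dvd u - v" "\<not> int q ^ Suc c dvd u - v"
    using W0 pq multiplicity_geI[OF W0, of "int q" "Suc c"]
    by (auto simp: c_def multiplicity_dvd prime_nat_iff simp del: power_Suc)
  have "\<not> int q dvd u" using prime_not_dvd_u[OF q(1), of 1] qW by simp
  hence nq: "\<not> int q dvd qsum u v n"
    using dvd_qsum_iff[OF qW, of n] pq cop_mn q
    by (metis coprime_common_divisor_nat int_dvd_int_iff not_prime_1 prime_dvd_mult_iff prime_dvd_power)
  have no: False if "int q ^ Suc c dvd u ^ n - v ^ n"
  proof -
    have "int q ^ Suc c dvd (u - v) * qsum u v n" using that by (simp add: qsum_mult)
    moreover have "coprime (int q ^ Suc c) (qsum u v n)"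
      using nq pq by (simp add: prime_imp_coprime)
    ultimately show False using c(2) by (simp add: coprime_dvd_mult_left_iff)
  qed
  have TW: "int q ^ c * qsum u v q dvd u ^ m - v ^ m"
    using mult_dvd_mono[OF c(1) qsum_dvd_mono[OF q(2)]] by (simp only: qsum_mult)
  show False
  proof (cases "\<exists>p. prime p \<and> p \<noteq> q \<and> int p dvd qsum u v q")
    case True
    then obtain p where p: "prime p" "p \<noteq> q" "int p dvd qsum u v q" by blast
    have "int p dvd u ^ q - v ^ q" using p(3) by (simp flip: qsum_mult)
    have pW: "\<not> int p dvd u - v"
    proof
      assume "int p dvd u - v"
      hence "int p dvd int q * u ^ (q - 1)" using dvd_qsum_iff p(3) by blast
      moreover have "\<not> int p dvd u" using prime_not_dvd_u[OF p(1), of 1] \<open>int p dvd u - v\<close> by simp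
      ultimately show False
        using p(1,2) q(1) by (metis int_dvd_int_iff prime_dvd_mult_iff prime_dvd_power primes_dvd_imp_eq prime_nat_int_transfer)
    qed
    have qp: "q dvd p - 1"
      using prime_dvd_pred_of_dvd_power_diff[OF p(1) q(1) cop, of 1] \<open>int p dvd u ^ q - v ^ q\<close> pW q
      by (auto simp: prime_nat_iff)
    \<comment> \<open>The quotient is divisible by q as well as by p, so u^m - v^m is divisible by
      q^(c+1) p. In the totient of this divisor, q^c comes from the power of q and one more q from p
      - 1.\<close>
    have "int q dvd qsum u v q" using dvd_qsum_iff[OF qW, of q] by simp
    hence "int q * int p dvd qsum u v q"
      using p q(1) by (intro divides_mult) (auto simp: primes_coprime)
    from dvd_trans[OF mult_dvd_mono[OF dvd_refl[of "int q ^ c"] this] TW]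
    have "int (q ^ Suc c * p) dvd u ^ m - v ^ m" by (simp add: mult_ac)
    hence "totient (q ^ Suc c * p) dvd totient (nat (u ^ m - v ^ m))"
      by (intro Totient.totient_dvd) (simp add: dvd_N_iff)
    moreover have "totient (q ^ Suc c * p) = q ^ c * (q - 1) * (p - 1)"
      using p q(1) by (subst totient_mult_coprime)
        (auto simp: totient_prime_power_Suc totient_prime primes_coprime simp del: power_Suc)
    moreover have "q ^ Suc c dvd q ^ c * (q - 1) * (p - 1)"
      using qp by (metis dvd_mult dvd_refl mult.assoc mult.commute mult_dvd_mono power_Suc2)
    ultimately have "int (q ^ Suc c) dvd u ^ n - v ^ n" by (metis dvd_totient_imp_dvd dvd_trans)
    thus False using no by simp
  next
    case False
    have pos: "nat (qsum u v q) > q" using qsum_prime_gt[OF q(1) \<open>odd q\<close>] by simp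
    have "\<exists>f. nat (qsum u v q) = q ^ f"
    proof -
      have "p = q" if "prime p" "p dvd nat (qsum u v q)" for p
        using that False pos by (auto simp: nat_dvd_iff simp flip: int_dvd_int_iff split: if_splits)
      hence "prime_factors (nat (qsum u v q)) \<subseteq> {q}" by (auto simp: prime_factors_dvd)
      moreover have "nat (qsum u v q) = (\<Prod>p\<in>prime_factors (nat (qsum u v q)). p ^ multiplicity p (nat (qsum u v q)))"
        using pos by (intro prime_factorization_nat) auto
      ultimately show ?thesis
        by (metis (no_types, lifting) power_0 prod.empty prod.insert subset_singletonD finite.emptyI empty_iff mult.right_neutral)
    qed
    then obtain f where f: "nat (qsum u v q) = q ^ f" by blast
    have "f \<ge> 2"
    proof (rule ccontr)
      assume "\<not> f \<ge> 2"
      hence "f = 0 \<or> f = 1" by auto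
      thus False using pos f q(1) prime_gt_1_nat by fastforce
    qed
    have "qsum u v q = int q ^ f" using f qsum_pos[OF \<open>odd q\<close>] by (simp flip: of_nat_power)
    hence "int q ^ 2 dvd qsum u v q" using \<open>f \<ge> 2\<close> by (simp add: le_imp_power_dvd)
    from dvd_trans[OF mult_dvd_mono[OF dvd_refl[of "int q ^ c"] this] TW]
    have "int q ^ c * int q ^ 2 dvd u ^ m - v ^ m" .
    hence "q ^ Suc (Suc c) dvd nat (u ^ m - v ^ m)"
      by (simp add: dvd_N_iff power2_eq_square mult_ac)
    from Totient.totient_dvd[OF this] have "q ^ Suc c dvd totient (nat (u ^ m - v ^ m))"
      unfolding totient_prime_power_Suc[OF q(1)] by (rule dvd_mult_left)
    from dvd_totient_imp_dvd[OF this] show False using no by simp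
  qed
qed

section \<open>Primes of B that are 1 modulo a given prime of m\<close>

definition Bq :: "nat \<Rightarrow> nat set" where
  "Bq q = {p \<in> B. q dvd p - 1}"

lemma prime_factor_ge_3:
  assumes "q \<in> prime_factors m"
  shows "3 \<le> q" "odd q" "prime q" "q dvd m"
proof -
  show q: "prime q" "q dvd m" using assms by auto
  show "odd q" using q odd_m by auto
  hence "q \<noteq> 2" by auto
  thus "3 \<le> q" using prime_ge_2_nat[OF q(1)] by linarith
qed

text \<open>If m and p - 1 were coprime, Fermat and \<open>dvd_power_diff_gcd\<close> would give p |
  u - v; so a common prime of m and p - 1 exists.\<close>

lemma B_eq_Union: "B = (\<Union>q\<in>prime_factors m. Bq q)"
proof (intro equalityI subsetI)
  fix p assume p: "p \<in> B"
  hence p': "prime p" "int p dvd u ^ m - v ^ m" "\<not> int p dvd u - v" by (auto simp: B_def)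
  note nd = prime_not_dvd_u[OF p'(1,2) m_pos]
  have "gcd m (p - 1) \<noteq> 1"
  proof
    assume "gcd m (p - 1) = 1"
    moreover have "int p dvd u ^ gcd m (p - 1) - v ^ gcd m (p - 1)"
      using p' nd by (intro dvd_power_diff_gcd prime_dvd_power_diff_fermat
          coprime_of_dvd_power_diff(2)[OF cop p'(2) m_pos])
    ultimately show False using p'(3) by simp
  qed
  then obtain q where "prime q" "q dvd gcd m (p - 1)" using prime_factor_nat by blast
  thus "p \<in> (\<Union>q\<in>prime_factors m. Bq q)" using p m_pos by (auto simp: Bq_def prime_factors_dvd)
qed (auto simp: Bq_def)

text \<open>Let M = \<open>card (Bq q)\<close>. Each p - 1 with p in \<open>Bq q\<close> contributes
  a factor q to the totient, so q^M divides u^n - v^n. As q does not divide n, passing to the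
  exponent (q - 1) n and removing a cofactor prime to q leaves q^M dividing u^(q-1) - v^(q-1) = (u^h
  - v^h) (u^h + v^h), where h = (q - 1)/2. Only one of the two factors can contain q.\<close>

lemma power_card_Bq_less:
  assumes q: "q \<in> prime_factors m"
  shows "int q ^ card (Bq q) < u ^ ((q - 1) div 2)"
proof -
  note q' = prime_factor_ge_3[OF q]
  define h where "h = (q - 1) div 2"
  have h: "q - 1 = 2 * h" "h > 0" using q' by (auto simp: h_def)
  define M where "M = card (Bq q)"
  have fin: "finite (Bq q)" using finite_B by (simp add: Bq_def)
  show ?thesis
  proof (cases "M = 0")
    case True
    thus ?thesis using h u_ge by (simp add: M_def flip: h_def)
  next
    case False
    have "\<Prod>(Bq q) dvd nat (u ^ m - v ^ m)"
      using fin by (intro prod_primes_dvd) (auto simp: Bq_def B_def dvd_N_iff)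
    hence "totient (\<Prod>(Bq q)) dvd totient (nat (u ^ m - v ^ m))" by (rule Totient.totient_dvd)
    moreover have "totient (\<Prod>(Bq q)) = (\<Prod>p\<in>Bq q. p - 1)"
    proof -
      have "totient (\<Prod>(Bq q)) = (\<Prod>p\<in>Bq q. totient p)"
        by (rule totient_prod_coprime) (auto simp: Bq_def B_def pairwise_def primes_coprime inj_on_def)
      also have "\<dots> = (\<Prod>p\<in>Bq q. p - 1)"
        by (intro prod.cong) (auto simp: Bq_def B_def totient_prime)
      finally show ?thesis .
    qed
    moreover have "q ^ M dvd (\<Prod>p\<in>Bq q. p - 1)"
      using prod_dvd_prod[of "Bq q" "\<lambda>_. q" "\<lambda>p. p - 1"] by (simp add: M_def Bq_def)
    ultimately have "q ^ M dvd totient (nat (u ^ m - v ^ m))" by (metis dvd_trans)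
    from dvd_totient_imp_dvd[OF this] have qM: "int q ^ M dvd u ^ n - v ^ n" by simp
    have qn: "int q dvd u ^ n - v ^ n" by (rule dvd_trans[OF dvd_power qM]) (use False in auto)
    note nd = prime_not_dvd_u[OF q'(3) qn n_pos]
    have f: "int q dvd u ^ (q - 1) - v ^ (q - 1)"
      by (rule prime_dvd_power_diff_fermat[OF q'(3) nd])
    define T where "T = qsum (u ^ (q - 1)) (v ^ (q - 1)) n"
    have pq: "prime (int q)" using q'(3) by simp
    have "\<not> q dvd n"
      using cop_mn q'(3,4) by (metis coprime_common_divisor_nat not_prime_1)
    hence "\<not> int q dvd T"
      unfolding T_def dvd_qsum_iff[OF f] using nd pq
      by (metis int_dvd_int_iff prime_dvd_mult_iff prime_dvd_power)
    hence cT: "coprime (int q ^ M) T" using pq by (simp add: prime_imp_coprime)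
    have "u ^ n - v ^ n dvd u ^ ((q - 1) * n) - v ^ ((q - 1) * n)"
      by (rule dvd_power_diff_mono) simp
    also have "u ^ ((q - 1) * n) - v ^ ((q - 1) * n) = (u ^ (q - 1) - v ^ (q - 1)) * T"
      unfolding T_def qsum_mult by (simp add: power_mult)
    finally have "int q ^ M dvd (u ^ (q - 1) - v ^ (q - 1)) * T" using qM dvd_trans by blast
    hence "int q ^ M dvd u ^ (q - 1) - v ^ (q - 1)"
      using cT by (simp add: coprime_dvd_mult_left_iff)
    also have "u ^ (q - 1) - v ^ (q - 1) = (u ^ h - v ^ h) * (u ^ h + v ^ h)"
      unfolding h(1) mult_2 power_add by (simp add: algebra_simps)
    finally have prod: "int q ^ M dvd (u ^ h - v ^ h) * (u ^ h + v ^ h)" .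
    \<comment> \<open>Both factors are even and below 2 u^h; since q is odd, the 2 can be divided
      out.\<close>
    have bound: "int q ^ M < u ^ h" if "int q ^ M dvd x" "0 < x" "x < 2 * u ^ h" "even x" for x
    proof -
      have "coprime (int q ^ M) 2" using q'(2) by simp
      hence "int q ^ M * 2 dvd x" using that by (intro divides_mult)
      hence "int q ^ M * 2 \<le> x" using that(2) by (rule zdvd_imp_le)
      thus ?thesis using that(3) by simp
    qed
    have ab: "\<bar>v ^ h\<bar> < u ^ h" using abs_power_less[OF h(2)] .
    have "\<not> (int q dvd u ^ h - v ^ h \<and> int q dvd u ^ h + v ^ h)"
    proof
      assume "int q dvd u ^ h - v ^ h \<and> int q dvd u ^ h + v ^ h"
      hence "int q dvd (u ^ h - v ^ h) + (u ^ h + v ^ h)" using dvd_add by blast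
      hence "int q dvd 2 * u ^ h" by simp
      hence "int q dvd 2" using pq nd by (metis prime_dvd_mult_iff prime_dvd_power)
      hence "int q \<le> 2" by (rule zdvd_imp_le) simp
      thus False using q'(1) by simp
    qed
    hence "coprime (int q ^ M) (u ^ h + v ^ h) \<or> coprime (int q ^ M) (u ^ h - v ^ h)"
      using pq by (metis coprime_power_left_iff prime_imp_coprime)
    hence "int q ^ M dvd u ^ h - v ^ h \<or> int q ^ M dvd u ^ h + v ^ h"
      using prod by (metis coprime_dvd_mult_left_iff coprime_dvd_mult_right_iff)
    thus ?thesis unfolding M_def[symmetric] h_def[symmetric]
      using ab odd_u odd_v by (auto intro!: bound)
  qed
qed

text \<open>Since p and q are odd, p = 1 + 2 q s with a positive integer s, and distinct p have
  distinct s.\<close>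

lemma sum_Bq_le:
  assumes q: "q \<in> prime_factors m"
  shows "(\<Sum>p\<in>Bq q. 1 / (real p - 1)) \<le> harm (card (Bq q)) / (2 * real q)"
proof -
  note q' = prime_factor_ge_3[OF q]
  have fin: "finite (Bq q)" using finite_B by (simp add: Bq_def)
  define f where "f = (\<lambda>p. (p - 1) div (2 * q))"
  have f: "p - 1 = 2 * q * f p" "p > 1" if "p \<in> Bq q" for p
  proof -
    show "p > 1" using that prime_gt_1_nat by (auto simp: Bq_def B_def)
    have "2 dvd p - 1" using B_odd[of p] that by (auto simp: Bq_def)
    hence "2 * q dvd p - 1" using that q'(2) by (intro divides_mult) (auto simp: Bq_def)
    thus "p - 1 = 2 * q * f p" by (simp add: f_def)
  qed
  have inj: "inj_on f (Bq q)"
    using f by (intro inj_onI) (metis Suc_diff_1 less_trans zero_less_one)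
  have "0 \<notin> f ` Bq q" using f by force
  hence "(\<Sum>s\<in>f ` Bq q. 1 / real s) \<le> harm (card (f ` Bq q))"
    using fin by (intro sum_inverse_le_harm) auto
  hence *: "(\<Sum>p\<in>Bq q. 1 / real (f p)) \<le> harm (card (Bq q))"
    using inj by (simp add: sum.reindex card_image)
  have "(\<Sum>p\<in>Bq q. 1 / (real p - 1)) = (\<Sum>p\<in>Bq q. 1 / real (f p)) / (2 * real q)"
    unfolding sum_divide_distrib
  proof (intro sum.cong refl)
    fix p assume p: "p \<in> Bq q"
    have "real p - 1 = real (p - 1)" using f(2)[OF p] by (simp add: of_nat_diff)
    also have "\<dots> = 2 * real q * real (f p)" unfolding f(1)[OF p] by simp
    finally show "1 / (real p - 1) = 1 / real (f p) / (2 * real q)" by simp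
  qed
  also have "\<dots> \<le> harm (card (Bq q)) / (2 * real q)"
    using * q' by (intro divide_right_mono) auto
  finally show ?thesis .
qed

text \<open>A prime dividing both u - v and the quotient would divide d and hence m, which
  \<open>not_dvd_diff\<close> forbids.\<close>

lemma prime_dvd_qsum_in_B:
  assumes "prime p" "d dvd m" "int p dvd qsum u v d"
  shows "p \<in> B"
proof -
  have "int p dvd qsum u v m" using assms(3) qsum_dvd_mono[OF assms(2)] dvd_trans by blast
  hence pm: "int p dvd u ^ m - v ^ m" by (simp flip: qsum_mult)
  have "\<not> int p dvd u - v"
  proof
    assume W: "int p dvd u - v"
    hence "int p dvd int d * u ^ (d - 1)" using assms(3) dvd_qsum_iff by blast
    moreover have "\<not> int p dvd u" using prime_not_dvd_u[OF assms(1) pm m_pos] by simp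
    ultimately have "p dvd d"
      using assms(1) by (metis int_dvd_int_iff prime_dvd_mult_iff prime_dvd_power prime_nat_int_transfer)
    hence "p dvd m" using assms(2) dvd_trans by blast
    thus False using not_dvd_diff[OF assms(1)] W by simp
  qed
  thus ?thesis using pm assms(1) by (simp add: B_def)
qed

lemma squarefree_qsum:
  assumes "d dvd m"
  shows "squarefree (qsum u v d)"
proof -
  have "odd d" using assms odd_m by auto
  hence nz: "qsum u v d \<noteq> 0" using qsum_pos by fastforce
  show ?thesis unfolding squarefree_factorial_semiring[OF nz]
  proof (intro allI impI notI)
    fix P :: int assume P: "prime P" "P ^ 2 dvd qsum u v d"
    define p where "p = nat P"
    have Pp: "P = int p" using P(1) by (simp add: p_def prime_ge_0_int)
    have p: "prime p" "(int p) ^ 2 dvd qsum u v d" using P by (simp_all add: Pp)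
    have "int p dvd qsum u v d" using p(2) by (simp add: power2_eq_square dvd_mult_left)
    hence "p \<in> B" using p assms by (intro prime_dvd_qsum_in_B)
    moreover have "(int p)\<^sup>2 dvd u ^ m - v ^ m"
      unfolding qsum_mult[symmetric] using p(2) qsum_dvd_mono[OF assms] by (meson dvd_mult dvd_trans)
    ultimately show False using B_exact by blast
  qed
qed

text \<open>
  Without a primitive prime the squarefree quotient $(u^d - v^d)/(u - v)$ would divide the product
  of the quotients belonging to $d/q$, which is too small because $\sum_{q \in I} d/q < d$.
\<close>

lemma exists_primitive:
  assumes I: "I \<subseteq> prime_factors m" "I \<noteq> {}" "card I \<le> 3"
  shows "\<exists>p\<in>B. int p dvd u ^ \<Prod>I - v ^ \<Prod>I \<and> (\<forall>q\<in>I. \<not> int p dvd u ^ \<Prod>(I - {q}) - v ^ \<Prod>(I - {q}))"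
proof (rule ccontr)
  assume none: "\<not> ?thesis"
  have fin: "finite I" using I(1) finite_subset by blast
  have dm: "\<Prod>J dvd m" if "J \<subseteq> I" for J
    using that I(1) fin by (intro prod_primes_dvd) (auto intro: finite_subset)
  have od: "odd (\<Prod>J)" if "J \<subseteq> I" for J
    using dm[OF that] odd_m dvd_trans by blast
  let ?R = "\<Prod>q\<in>I. qsum u v (\<Prod>(I - {q}))"
  have pos: "0 < qsum u v (\<Prod>(I - {q}))" for q using od[of "I - {q}"] by (auto intro: qsum_pos)
  have "qsum u v (\<Prod>I) dvd ?R"
  proof (rule squarefree_dvdI)
    show "squarefree (qsum u v (\<Prod>I))" by (rule squarefree_qsum[OF dm]) simp
    show "?R \<noteq> 0" using pos fin by (auto simp: less_le)
    fix P :: int assume P: "prime P" "P dvd qsum u v (\<Prod>I)"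
    define p where "p = nat P"
    have Pp: "P = int p" using P(1) by (simp add: p_def prime_ge_0_int)
    have p: "prime p" "int p dvd qsum u v (\<Prod>I)" using P by (simp_all add: Pp)
    have pB: "p \<in> B" using p dm by (intro prime_dvd_qsum_in_B) auto
    have "int p dvd u ^ \<Prod>I - v ^ \<Prod>I" using p(2) by (simp flip: qsum_mult)
    then obtain q where q: "q \<in> I" "int p dvd u ^ \<Prod>(I - {q}) - v ^ \<Prod>(I - {q})"
      using none pB by blast
    hence "int p dvd qsum u v (\<Prod>(I - {q}))"
      using pB p(1) by (auto simp: B_def prime_dvd_mult_iff simp flip: qsum_mult)
    also have "\<dots> dvd ?R" using q(1) fin by (intro dvd_prodI) auto
    finally show "P dvd ?R" by (simp add: Pp)
  qed
  moreover have "?R > 0" using pos by (intro prod_pos) auto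
  ultimately have le: "qsum u v (\<Prod>I) \<le> ?R" by (intro zdvd_imp_le)
  have "u ^ (\<Prod>I - 1) < 2 * qsum u v (\<Prod>I)" by (rule qsum_lower[OF od]) simp
  also have "\<dots> \<le> 2 * ?R" using le by simp
  \<comment> \<open>One factor 2 is supplied for each q in I, so that \<open>qsum_upper\<close>
    applies factor by factor.\<close>
  also have "\<dots> \<le> 2 ^ card I * ?R"
  proof (rule mult_right_mono)
    show "(2::int) \<le> 2 ^ card I" using I(2) fin by (intro self_le_power) (auto simp: card_gt_0_iff)
  qed (use \<open>?R > 0\<close> in simp)
  also have "\<dots> = (\<Prod>q\<in>I. 2 * qsum u v (\<Prod>(I - {q})))" by (simp add: prod.distrib)
  also have "\<dots> \<le> (\<Prod>q\<in>I. u ^ \<Prod>(I - {q}))"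
  proof (intro prod_mono conjI)
    fix q assume "q \<in> I"
    have "\<Prod>(I - {q}) > 0" using od[of "I - {q}"] by (auto intro: odd_pos)
    thus "2 * qsum u v (\<Prod>(I - {q})) \<le> u ^ \<Prod>(I - {q})" using qsum_upper by (simp add: less_imp_le)
    show "0 \<le> 2 * qsum u v (\<Prod>(I - {q}))" using pos[of q] by simp
  qed
  also have "\<dots> = u ^ (\<Sum>q\<in>I. \<Prod>(I - {q}))" by (simp add: power_sum)
  also have "\<dots> \<le> u ^ (\<Prod>I - 1)"
  proof (rule power_increasing)
    have "(\<Sum>q\<in>I. \<Prod>(I - {q})) < \<Prod>I"
      using fin I prime_factor_ge_3(1) by (intro sum_prod_remove_less_prod) auto
    thus "(\<Sum>q\<in>I. \<Prod>(I - {q})) \<le> \<Prod>I - 1" by simp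
  qed (use u_ge in simp)
  finally show False by simp
qed

text \<open>
  The primitive primes of distinct sets $I \ni q$ with at most three elements are distinct. With
  $k$ primes dividing $m$ there are $(k^2 - k + 2)/2$ such sets, and
  $8(k^2 - k + 2) - 7k^2 = (k - 4)^2$.
\<close>

lemma card_prime_factors_le:
  assumes q: "q \<in> prime_factors m"
  shows "7 * (card (prime_factors m))\<^sup>2 \<le> 16 * card (Bq q)"
proof -
  let ?P = "prime_factors m"
  define F where "F = {I. I \<subseteq> ?P \<and> q \<in> I \<and> card I \<le> 3}"
  have "\<forall>I\<in>F. \<exists>p\<in>B. int p dvd u ^ \<Prod>I - v ^ \<Prod>I \<and>
      (\<forall>r\<in>I. \<not> int p dvd u ^ \<Prod>(I - {r}) - v ^ \<Prod>(I - {r}))"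
    unfolding F_def by (intro ballI exists_primitive) auto
  then obtain f where f: "\<And>I. I \<in> F \<Longrightarrow> f I \<in> B" "\<And>I. I \<in> F \<Longrightarrow> int (f I) dvd u ^ \<Prod>I - v ^ \<Prod>I"
    "\<And>I r. I \<in> F \<Longrightarrow> r \<in> I \<Longrightarrow> \<not> int (f I) dvd u ^ \<Prod>(I - {r}) - v ^ \<Prod>(I - {r})"
    by metis
  have fin: "finite I" if "I \<in> F" for I using that finite_subset by (auto simp: F_def)
  have pos: "0 < \<Prod>J" if "J \<subseteq> ?P" for J using that by (intro prod_pos) (auto intro: prime_gt_0_nat)
  have eq: "\<Prod>I = r * \<Prod>(I - {r})" if "I \<in> F" "r \<in> I" for I r
    using that fin by (simp add: prod.remove)
  have nd: "\<not> r dvd \<Prod>(I - {s})" if I: "I \<in> F" and r: "r \<in> ?P" "r \<notin> I - {s}" for I r s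
  proof
    assume "r dvd \<Prod>(I - {s})"
    then obtain s' where "s' \<in> I - {s}" "r dvd s'"
      using prime_dvd_prod_iff[of "I - {s}" r id] fin[OF I] r(1) by auto
    moreover have "prime s'" using \<open>s' \<in> I - {s}\<close> I by (auto simp: F_def)
    ultimately have "r = s'" using r(1) primes_dvd_imp_eq in_prime_factors_imp_prime by blast
    thus False using \<open>s' \<in> I - {s}\<close> r(2) by simp
  qed
  \<comment> \<open>A prime shared by I and J divides the difference whose exponent is the gcd of
    the two products. If r lies in I but not in J, this gcd divides the product over I - {r},
    contradicting primitivity for I.\<close>
  have sub: "I \<subseteq> J" if IJ: "I \<in> F" "J \<in> F" "f I = f J" for I J
  proof
    fix r assume r: "r \<in> I"
    show "r \<in> J"
    proof (rule ccontr)
      assume rJ: "r \<notin> J"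
      have rP: "r \<in> ?P" "prime r" using r IJ(1) by (auto simp: F_def)
      let ?g = "gcd (\<Prod>I) (\<Prod>J)"
      have "int (f I) dvd u ^ ?g - v ^ ?g"
        using f(2)[OF IJ(1)] f(2)[OF IJ(2)] IJ(3)
        by (intro dvd_power_diff_gcd coprime_of_dvd_power_diff(2)[OF cop f(2)[OF IJ(1)] pos])
          (use IJ(1) in \<open>auto simp: F_def\<close>)
      moreover have "\<not> r dvd \<Prod>J" using nd[OF IJ(2) rP(1), of r] rJ by simp
      hence "coprime r ?g"
        using rP(2) by (metis dvd_trans gcd_dvd2 prime_imp_coprime)
      hence "?g dvd \<Prod>(I - {r})"
        using eq[OF IJ(1) r] gcd_dvd1[of "\<Prod>I" "\<Prod>J"] by (metis coprime_commute coprime_dvd_mult_right_iff)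
      ultimately have "int (f I) dvd u ^ \<Prod>(I - {r}) - v ^ \<Prod>(I - {r})"
        using dvd_power_diff_mono dvd_trans by blast
      thus False using f(3)[OF IJ(1) r] by simp
    qed
  qed
  have inj: "inj_on f F" using sub by (intro inj_onI) (simp add: set_eq_subset)
  have "f ` F \<subseteq> Bq q"
  proof safe
    fix I assume I: "I \<in> F"
    hence qI: "q \<in> I" by (simp add: F_def)
    have "q dvd f I - 1"
    proof (rule prime_dvd_pred_of_dvd_power_diff)
      show "prime (f I)" using f(1)[OF I] by (simp add: B_def)
      show "0 < \<Prod>(I - {q})" using I by (intro pos) (auto simp: F_def)
      show "int (f I) dvd u ^ (q * \<Prod>(I - {q})) - v ^ (q * \<Prod>(I - {q}))"
        using f(2)[OF I] eq[OF I qI] by simp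
      show "\<not> q dvd \<Prod>(I - {q})" using nd[OF I q, of q] by simp
    qed (use f(3)[OF I qI] q cop in auto)
    thus "f I \<in> Bq q" using f(1)[OF I] by (simp add: Bq_def)
  qed
  hence le: "card F \<le> card (Bq q)"
    using card_inj_on_le[OF inj] finite_B by (simp add: Bq_def)
  have cF: "card F = 1 + (card ?P - 1) + ((card ?P - 1) choose 2)"
    unfolding F_def using q by (intro card_subsets_with_le_3) auto
  have poly: "7 * k\<^sup>2 \<le> 16 * (1 + (k - 1) + ((k - 1) choose 2))" if "k > 0" for k :: nat
  proof -
    obtain j where k: "k = Suc j" using \<open>k > 0\<close> by (cases k) auto
    have "even (j * (j - 1))" by (cases j) auto
    hence "2 * (j choose 2) = j * (j - 1)" by (simp add: choose_two)
    moreover have "int (j * (j - 1)) = int j * (int j - 1)"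
      by (cases j) (simp_all add: algebra_simps)
    ultimately have "2 * int (j choose 2) = int j * (int j - 1)"
      by (metis of_nat_mult of_nat_numeral)
    moreover have "0 \<le> (int j - 3)\<^sup>2" by simp
    hence "7 * (int j + 1)\<^sup>2 \<le> 16 * (1 + int j) + 8 * (int j * (int j - 1))"
      by (simp add: power2_eq_square algebra_simps)
    ultimately have "7 * (int j + 1)\<^sup>2 \<le> 16 * (1 + int j + int (j choose 2))" by simp
    hence "int (7 * k\<^sup>2) \<le> int (16 * (1 + (k - 1) + ((k - 1) choose 2)))" by (simp add: k add_ac)
    thus ?thesis by (simp only: of_nat_le_iff)
  qed
  have "card ?P > 0" using q by (auto simp: card_gt_0_iff)
  hence "7 * (card ?P)\<^sup>2 \<le> 16 * card F"
    using poly[of "card ?P"] cF by simp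
  also have "\<dots> \<le> 16 * card (Bq q)" using le by simp
  finally show ?thesis .
qed

section \<open>Summation over B and the contradiction\<close>

lemma prime_factors_ne: "prime_factors m \<noteq> {}"
proof -
  have "m \<noteq> 1" using n_pos n_less by simp
  then obtain q where "prime q" "q dvd m" using prime_factor_nat by blast
  thus ?thesis using m_pos by (auto simp: prime_factors_dvd)
qed

lemma card_Bq_le:
  assumes q: "q \<in> prime_factors m"
  shows "real (card (Bq q)) \<le> (real q - 1) * ln u / (2 * ln (real q))"
proof -
  note q' = prime_factor_ge_3[OF q]
  define h where "h = (q - 1) div 2"
  have h: "q = 2 * h + 1" using q' by (auto simp: h_def elim!: oddE)
  have "real q ^ card (Bq q) \<le> (real_of_int u) ^ h"
    using power_card_Bq_less[OF q] unfolding h_def[symmetric]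
    by (metis less_imp_le of_int_of_nat_eq of_int_power of_int_le_iff)
  hence "ln (real q ^ card (Bq q)) \<le> ln ((real_of_int u) ^ h)"
    using q' u_ge by (subst ln_le_cancel_iff) auto
  hence "real (card (Bq q)) * ln (real q) \<le> real h * ln u"
    using q' u_ge by (simp add: ln_realpow)
  moreover have "ln (real q) > 0" using q' by simp
  moreover have "real q - 1 = 2 * real h" by (simp add: h)
  ultimately show ?thesis by (simp add: field_simps)
qed

text \<open>Let L = ln u, let q0 be the least prime of m and x = (q0 - 1) L / ln q0. Each class
  \<open>Bq q\<close> has sum at most sqrt(9x/64) / q0, and there are at most sqrt(8x/7) classes.
  The two roots multiply to a term linear in L, which \<open>odd_ln_bound\<close> brings below
  L/4.\<close>

lemma sum_B_le: "(\<Sum>p\<in>B. 1 / (real p - 1)) \<le> ln u / 4"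
proof -
  let ?P = "prime_factors m"
  define L where "L = ln (real_of_int u)"
  have L: "L > 0" using u_ge by (simp add: L_def)
  define q0 where "q0 = Min ?P"
  have q0: "q0 \<in> ?P" using prime_factors_ne by (simp add: q0_def)
  note q0' = prime_factor_ge_3[OF q0]
  define x where "x = (real q0 - 1) * L / ln (real q0)"
  have lq0: "ln (real q0) > 0" using q0' by simp
  have x: "x > 0" unfolding x_def using L lq0 q0' by (intro divide_pos_pos mult_pos_pos) auto
  define a where "a = (\<lambda>q. \<Sum>p\<in>Bq q. 1 / (real p - 1))"
  define k where "k = real (card ?P)"
  have a_nonneg: "0 \<le> a q" for q
    unfolding a_def by (intro sum_nonneg) (auto simp: Bq_def B_def dest!: prime_ge_1_nat)
  have a: "a q \<le> sqrt (9 / 64 * x) / real q0" if q: "q \<in> ?P" for q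
  proof -
    note q' = prime_factor_ge_3[OF q]
    have qq: "q0 \<le> q" using q by (simp add: q0_def)
    have lq: "ln (real q0) \<le> ln (real q)" using qq q0' by simp
    define M where "M = real (card (Bq q))"
    have "a q \<le> harm (card (Bq q)) / (2 * real q)" unfolding a_def by (rule sum_Bq_le[OF q])
    hence "(a q)\<^sup>2 \<le> (harm (card (Bq q)) / (2 * real q))\<^sup>2"
      using a_nonneg by (intro power_mono)
    also have "\<dots> = (harm (card (Bq q)))\<^sup>2 / (4 * (real q)\<^sup>2)" by (simp add: power_divide power_mult_distrib)
    also have "\<dots> \<le> (9 / 8 * M) / (4 * (real q)\<^sup>2)"
      unfolding M_def by (intro divide_right_mono harm_square_le) auto
    also have "\<dots> = 9 / 32 * (M / (real q)\<^sup>2)" by simp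
    also have "M / (real q)\<^sup>2 \<le> ((real q - 1) * L / (2 * ln (real q))) / (real q)\<^sup>2"
      unfolding M_def L_def by (intro divide_right_mono card_Bq_le[OF q]) auto
    also have "\<dots> \<le> ((real q - 1) * L / (2 * ln (real q0))) / (real q)\<^sup>2"
      using lq lq0 L q' by (intro divide_right_mono divide_left_mono mult_nonneg_nonneg mult_pos_pos) auto
    also have "\<dots> = ((real q - 1) / (real q)\<^sup>2) * (L / (2 * ln (real q0)))" by simp
    also have "\<dots> \<le> ((real q0 - 1) / (real q0)\<^sup>2) * (L / (2 * ln (real q0)))"
    proof (rule mult_right_mono)
      \<comment> \<open>Here (t - 1)/t^2 decreases from t = z to t = y: the cross difference factors
        as (y - z) (z y - y - z).\<close>
      define y z where "y = real q" and "z = real q0"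
      have yz: "y \<ge> z" "z \<ge> 3" using qq q0' by (auto simp: y_def z_def)
      have "2 * y \<le> z * y" using yz by (intro mult_right_mono) auto
      hence "0 \<le> z * y - y - z" using yz by linarith
      hence "0 \<le> (y - z) * (z * y - y - z)" using yz by simp
      also have "\<dots> = (z - 1) * y\<^sup>2 - (y - 1) * z\<^sup>2" by (simp add: power2_eq_square algebra_simps)
      finally have "(y - 1) * z\<^sup>2 \<le> (z - 1) * y\<^sup>2" by simp
      thus "(real q - 1) / (real q)\<^sup>2 \<le> (real q0 - 1) / (real q0)\<^sup>2"
        using yz unfolding y_def[symmetric] z_def[symmetric] by (subst frac_le_eq) (auto simp: divide_nonpos_pos mult_ac)
      show "0 \<le> L / (2 * ln (real q0))" using L lq0 by simp
    qed
    also have "\<dots> = x / (2 * (real q0)\<^sup>2)" by (simp add: x_def)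
    finally have "(a q)\<^sup>2 \<le> 9 / 64 * x / (real q0)\<^sup>2" by simp
    hence "a q \<le> sqrt (9 / 64 * x / (real q0)\<^sup>2)" by (rule real_le_rsqrt)
    also have "\<dots> = sqrt (9 / 64 * x) / sqrt ((real q0)\<^sup>2)" by (rule real_sqrt_divide)
    also have "sqrt ((real q0)\<^sup>2) = real q0" by simp
    finally show ?thesis .
  qed
  have "(\<Sum>p\<in>B. 1 / (real p - 1)) \<le> (\<Sum>q\<in>?P. a q)"
    unfolding B_eq_Union a_def
  proof (rule sum_UN_le)
    show "finite (Bq q)" for q using finite_B by (simp add: Bq_def)
  qed (auto simp: Bq_def B_def dest!: prime_ge_1_nat)
  also have "\<dots> \<le> (\<Sum>q\<in>?P. sqrt (9 / 64 * x) / real q0)" by (intro sum_mono a)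
  also have "\<dots> = k * (sqrt (9 / 64 * x) / real q0)" by (simp add: k_def)
  also have "\<dots> \<le> sqrt (8 / 7 * x) * (sqrt (9 / 64 * x) / real q0)"
  proof (rule mult_right_mono)
    have "real (7 * (card ?P)\<^sup>2) \<le> real (16 * card (Bq q0))"
      using card_prime_factors_le[OF q0] by (simp only: of_nat_le_iff)
    hence "7 * k\<^sup>2 \<le> 16 * real (card (Bq q0))" by (simp add: k_def)
    also have "\<dots> \<le> 16 * (x / 2)" using card_Bq_le[OF q0] by (simp add: x_def L_def mult.commute)
    finally show "k \<le> sqrt (8 / 7 * x)" by (intro real_le_rsqrt) simp
  qed (use x in simp)
  also have "\<dots> = sqrt (9 / 56 * x\<^sup>2) / real q0"
    by (simp add: power2_eq_square flip: real_sqrt_mult)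
  also have "\<dots> \<le> L / 4"
  proof -
    have "18 * (real q0 - 1)\<^sup>2 \<le> 7 * (real q0 * ln (real q0))\<^sup>2" using q0' by (intro odd_ln_bound)
    hence "18 * ((real q0 - 1)\<^sup>2 * L\<^sup>2) \<le> 7 * (real q0 * ln (real q0))\<^sup>2 * L\<^sup>2"
      unfolding mult.assoc[symmetric] by (rule mult_right_mono) simp
    hence "18 * x\<^sup>2 \<le> 7 * (real q0 * L)\<^sup>2"
      using lq0 by (simp add: x_def power_mult_distrib power_divide divide_le_eq mult_ac)
    hence "9 / 56 * x\<^sup>2 \<le> (real q0 * L / 4)\<^sup>2" by (simp add: power_divide)
    hence "sqrt (9 / 56 * x\<^sup>2) \<le> real q0 * L / 4"
      using L by (intro real_le_lsqrt) auto
    thus ?thesis using q0' by (simp add: field_simps)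
  qed
  finally show ?thesis by (simp add: L_def)
qed

text \<open>For v < 0 the parities help: v^m < 0 < v^n, so u^m - v^m > u^m >= u^(n+1) > u (u^n -
  v^n).\<close>

lemma power_diff_gt: "u * (u ^ n - v ^ n) < u ^ m - v ^ m"
proof (cases "v < 0")
  case True
  hence vm: "v ^ m < 0" using odd_m by (simp add: power_less_zero_eq)
  have "u ^ Suc n \<le> u ^ m" using n_less u_ge by (intro power_increasing) auto
  moreover have "v ^ n > 0" using even_n v_ne by (simp add: zero_less_power_eq)
  hence "u * v ^ n > 0" using u_ge by simp
  ultimately show ?thesis unfolding right_diff_distrib power_Suc using vm by linarith
next
  case False
  thus ?thesis using v_ne less n_pos n_less by (intro mult_power_diff_less) auto
qed

text \<open>The primes of N = u^m - v^m are those of W = u - v together with \<open>B\<close>, so N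
  / phi(N) is W / phi(W) divided by s. Here W / phi(W) <= u^(3/4) by
  \<open>diff_totient_bound\<close> and 1/s <= u^(1/4) by \<open>sum_B_le\<close>, whereas
  \<open>power_diff_gt\<close> makes N / phi(N) exceed u. Fourth powers avoid fractional
  exponents.\<close>

lemma inconsistent: False
proof -
  define N W where "N = nat (u ^ m - v ^ m)" and "W = nat (u - v)"
  have N: "N > 0" "int N = u ^ m - v ^ m" using power_diff_pos[OF m_pos] by (auto simp: N_def)
  have W: "W > 0" "int W = u - v" using diff_ge(1) by (auto simp: W_def)
  define s where "s = (\<Prod>p\<in>B. 1 - 1 / real p)"
  have pf: "prime_factors N = prime_factors W \<union> B"
  proof -
    have "p \<in> prime_factors N \<longleftrightarrow> prime p \<and> int p dvd u ^ m - v ^ m" for p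
      using N by (simp add: prime_factors_dvd flip: N(2))
    moreover have "p \<in> prime_factors W \<longleftrightarrow> prime p \<and> int p dvd u - v" for p
      using W by (simp add: prime_factors_dvd flip: W(2))
    moreover have "u - v dvd u ^ m - v ^ m" using dvd_power_diff_mono[of 1 m u v] by simp
    ultimately show ?thesis unfolding B_def using dvd_trans by blast
  qed
  have disj: "prime_factors W \<inter> B = {}"
    using W by (auto simp: B_def prime_factors_dvd simp flip: W(2))
  have tN: "real (totient N) = real N * ((\<Prod>p\<in>prime_factors W. 1 - 1 / real p) * s)"
    unfolding totient_formula2 pf s_def using disj finite_B by (subst prod.union_disjoint) auto
  have tW: "real (totient W) = real W * (\<Prod>p\<in>prime_factors W. 1 - 1 / real p)"
    by (rule totient_formula2)
  have eq: "real (totient N) * real W = real N * real (totient W) * s" unfolding tN tW by simp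
  have s4: "1 \<le> s ^ 4 * u"
  proof -
    \<comment> \<open>Inverting 1 - 1/p gives 1 + 1/(p - 1) <= exp(1/(p - 1)); this turns the
      product s into the sum bounded by \<open>sum_B_le\<close>.\<close>
    have "exp (- 1 / (real p - 1)) \<le> 1 - 1 / real p" if "p \<in> B" for p
    proof -
      have p: "p > 1" using that prime_gt_1_nat by (auto simp: B_def)
      have "1 / (1 - 1 / real p) = 1 + 1 / (real p - 1)" using p by (simp add: field_simps)
      also have "\<dots> \<le> exp (1 / (real p - 1))" by (rule exp_ge_add_one_self)
      finally have "1 / exp (1 / (real p - 1)) \<le> 1 - 1 / real p" using p by (simp add: field_simps)
      thus ?thesis by (simp add: exp_minus inverse_eq_divide flip: minus_divide_left)
    qed
    hence "(\<Prod>p\<in>B. exp (- 1 / (real p - 1))) \<le> s" unfolding s_def by (intro prod_mono) auto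
    also have "(\<Prod>p\<in>B. exp (- 1 / (real p - 1))) = exp (- (\<Sum>p\<in>B. 1 / (real p - 1)))"
      by (simp add: exp_sum[OF finite_B, symmetric] sum_negf[symmetric])
    finally have "exp (- ln (real_of_int u) / 4) \<le> s" using sum_B_le
      by (smt (verit) exp_le_cancel_iff minus_divide_left)
    hence "exp (- ln (real_of_int u) / 4) ^ 4 \<le> s ^ 4" by (intro power_mono) auto
    moreover have "exp (- ln (real_of_int u) / 4) ^ 4 = 1 / u"
    proof -
      have "exp (- ln (real_of_int u) / 4) ^ 4 = exp (real 4 * (- ln (real_of_int u) / 4))"
        by (simp only: exp_of_nat_mult)
      also have "\<dots> = 1 / u" using u_ge by (simp add: exp_minus inverse_eq_divide)
      finally show ?thesis .
    qed
    ultimately have "1 / real_of_int u \<le> s ^ 4" by simp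
    thus ?thesis using u_ge by (simp add: field_simps)
  qed
  have W4: "real W ^ 4 \<le> real (totient W) ^ 4 * real_of_int u ^ 3"
  proof -
    have "real_of_int (int (W ^ 4)) \<le> real_of_int (int (totient W ^ 4) * u ^ 3)"
      using diff_totient_bound unfolding W_def of_int_le_iff .
    thus ?thesis by simp
  qed
  have "int (totient N) \<le> u ^ n - v ^ n"
    using zdvd_imp_le[OF totient_dvd_diff power_diff_pos[OF n_pos]] by (simp add: N_def)
  hence "u * int (totient N) \<le> u * (u ^ n - v ^ n)" using u_ge by simp
  also have "\<dots> < int N" using power_diff_gt N(2) by simp
  finally have "real_of_int (u * int (totient N)) < real_of_int (int N)" by (simp only: of_int_less_iff)
  hence lt: "real_of_int u * real (totient N) < real N" by simp
  have tp: "real (totient W) > 0" "real (totient N) > 0" "real W > 0" using W N by auto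
  have "(real_of_int u * real (totient N)) ^ 4 < real N ^ 4"
    using lt u_ge by (intro power_strict_mono) auto
  hence "(real_of_int u * real (totient N)) ^ 4 * real W ^ 4 < real N ^ 4 * real W ^ 4"
    using tp by simp
  also have "(real_of_int u * real (totient N)) ^ 4 * real W ^ 4 = (real_of_int u) ^ 4 * (real (totient N) * real W) ^ 4"
    by (simp add: power_mult_distrib)
  also have "\<dots> = real N ^ 4 * (real (totient W) ^ 4 * real_of_int u ^ 3) * (s ^ 4 * real_of_int u)"
    unfolding eq by (simp add: power_mult_distrib numeral_eq_Suc)
  finally have "real N ^ 4 * (real (totient W) ^ 4 * real_of_int u ^ 3) * (s ^ 4 * real_of_int u) < real N ^ 4 * real W ^ 4" .
  moreover have "real N ^ 4 * real W ^ 4 * 1 \<le>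
      real N ^ 4 * (real (totient W) ^ 4 * real_of_int u ^ 3) * (s ^ 4 * real_of_int u)"
    using W4 s4 u_ge by (intro mult_mono mult_nonneg_nonneg) auto
  ultimately show False by simp
qed

end

section \<open>The remaining exponents\<close>

text \<open>The two sides differ by a b (a^(m-2) - b^(m-2)), which is nonnegative and vanishes only
  for m = 2.\<close>

lemma mult_power_sum_le:
  fixes a b :: int
  assumes "0 < b" "b < a" "2 \<le> m"
  shows "(a - b) * (a ^ (m - 1) + b ^ (m - 1)) \<le> a ^ m - b ^ m"
    and "(a - b) * (a ^ (m - 1) + b ^ (m - 1)) = a ^ m - b ^ m \<Longrightarrow> m = 2"
proof -
  obtain j where m: "m = Suc (Suc j)" using assms(3) by (metis add_2_eq_Suc le_Suc_ex)
  have id: "a ^ m - b ^ m = (a - b) * (a ^ (m - 1) + b ^ (m - 1)) + a * b * (a ^ j - b ^ j)"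
    by (simp add: m algebra_simps)
  have "b ^ j \<le> a ^ j" using assms by (intro power_mono) auto
  thus "(a - b) * (a ^ (m - 1) + b ^ (m - 1)) \<le> a ^ m - b ^ m"
    unfolding id using assms by simp
  assume "(a - b) * (a ^ (m - 1) + b ^ (m - 1)) = a ^ m - b ^ m"
  hence "a ^ j = b ^ j" using id assms by simp
  hence "j = 0" using power_strict_mono[of b a j] assms by fastforce
  thus "m = 2" by (simp add: m)
qed

lemma odd_totient_imp_le_2:
  assumes "odd (totient w)"
  shows "w \<le> 2"
  using assms totient_even[of w] by linarith

text \<open>Two coprime odd factors greater than 1 would each contribute an even totient. So w is 1
  or a power of a prime p >= 3, and in the latter case phi(w)/w = 1 - 1/p >= 2/3.\<close>

lemma three_totient_ge:
  assumes "odd w" "\<not> 4 dvd totient w"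
  shows "2 * w \<le> 3 * totient w"
proof (cases "w = 1")
  case False
  then obtain p where p: "prime p" "p dvd w" using prime_factor_nat by blast
  have "odd p" using p(2) assms(1) dvd_trans by blast
  hence "p \<noteq> 2" by auto
  hence p3: "p \<ge> 3" using prime_ge_2_nat[OF p(1)] by linarith
  have w0: "w \<noteq> 0" using assms(1) by (rule contrapos_nn) simp
  have "\<not> is_unit p" using p(1) by auto
  from multiplicity_decompose'[OF w0 this] obtain y where y: "w = p ^ multiplicity p w * y" "\<not> p dvd y"
    by blast
  have "multiplicity p w \<ge> 1" using p w0 by (intro multiplicity_geI) auto
  then obtain j where j: "multiplicity p w = Suc j" by (cases "multiplicity p w") auto
  have cop: "coprime (p ^ Suc j) y" using p(1) y(2) by (simp add: prime_imp_coprime del: power_Suc)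
  have t: "totient w = totient (p ^ Suc j) * totient y"
    using y(1) j cop totient_mult_coprime by simp
  have "odd y" using y(1) assms(1) by (metis even_mult_iff)
  have "y = 1"
  proof (rule ccontr)
    assume "y \<noteq> 1"
    hence "y > 2" using \<open>odd y\<close> by presburger
    hence "even (totient y)" by (rule totient_even)
    moreover have "even (totient (p ^ Suc j))"
      using p(1) \<open>odd p\<close> by (simp add: totient_prime_power_Suc del: power_Suc)
    ultimately have "2 * 2 dvd totient w" unfolding t by (intro mult_dvd_mono)
    thus False using assms(2) by simp
  qed
  hence w: "w = p ^ j * p" and tw: "totient w = p ^ j * (p - 1)"
    using y(1) j t p(1) by (simp_all add: totient_prime_power_Suc mult.commute del: power_Suc) (simp add: mult.commute)
  have "2 * p \<le> 3 * (p - 1)" using p3 by simp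
  hence "p ^ j * (2 * p) \<le> p ^ j * (3 * (p - 1))" by (rule mult_le_mono2)
  thus ?thesis unfolding tw by (simp add: w mult_ac)
qed simp

text \<open>The primes of d already divide d N, so each further factor d multiplies the totient by
  d.\<close>

lemma totient_power_mult: "totient (d ^ Suc k * N) = d ^ k * totient (d * N)"
proof (induction k)
  case (Suc k)
  have "totient (d * (d * M)) = d * totient (d * M)" for M
  proof (cases "d = 0")
    case False
    thus ?thesis using totient_gcd[of d "d * M"] by simp
  qed simp
  from this[of "d ^ k * N"] Suc show ?case by (simp add: mult_ac)
qed simp

text \<open>For g = gcd(d, k) the formula \<open>totient_gcd\<close> reduces to phi(g) = g phi(d) >=
  g, so g = 1 and phi(d) = 1. Then d <= 2, and d = 2 would share a factor with the even k.\<close>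

lemma totient_mult_eq_imp_1:
  assumes "totient (d * k) = totient k" "even k" "0 < k" "0 < d"
  shows "d = 1"
proof -
  define g where "g = gcd d k"
  have g: "g > 0" "g dvd d" using assms by (auto simp: g_def)
  have "totient k * totient g = totient d * totient k * g"
    using totient_gcd[of d k] assms(1) by (simp add: g_def)
  hence e: "totient g = totient d * g" using assms(3) by simp
  have "0 < totient d" using assms(4) by simp
  hence "g \<le> totient g" unfolding e by (simp add: Suc_le_eq)
  hence g1: "g = 1" using totient_less[of g] g(1) by (cases "g = 1") auto
  hence "totient d = 1" using e by simp
  hence "d \<le> 2" using odd_totient_imp_le_2[of d] by simp
  moreover have "d \<noteq> 2" using g1 assms(2) by (auto simp: g_def)
  ultimately show ?thesis using assms(4) by simp
qed

context odd_pair
begin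

text \<open>Let c be the power of 2 in n, A = u^c - v^c and K = u^n - v^n. As K / A is odd, A holds
  all factors 2 of K; moreover A divides N = 2^e w. Since phi(N) = 2^(e-1) phi(w) divides K, a
  factor 4 in phi(w) would put 2^(e+1) into A and so into N. This yields N <= 3 K, and comparing
  sizes does the rest.\<close>

lemma exponents_of_totient_dvd:
  fixes m n :: nat
  assumes mn: "0 < n" "n < m" "2 ^ multiplicity 2 n dvd m"
    and dvd: "int (totient (nat (u ^ m - v ^ m))) dvd u ^ n - v ^ n"
  shows "m = 2 \<and> n = 1 \<and> u + v = 2 \<and> (\<exists>e. u - v = 2 ^ e)"
proof -
  have m0: "0 < m" using mn by simp
  define c where "c = (2::nat) ^ multiplicity 2 n"
  obtain n' where n': "n = c * n'" "odd n'"
    using multiplicity_decompose'[of n 2] mn(1) unfolding c_def by (metis less_not_refl odd_one)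
  define A where "A = u ^ c - v ^ c"
  have c: "c > 0" "c dvd m" using mn(3) by (auto simp: c_def)
  have evA: "even A" using odd_u odd_v by (simp add: A_def)
  define K where "K = u ^ n - v ^ n"
  have K: "K > 0" unfolding K_def by (rule power_diff_pos[OF mn(1)])
  define N where "N = nat (u ^ m - v ^ m)"
  have N: "N > 0" "int N = u ^ m - v ^ m" using power_diff_pos[OF m0] by (auto simp: N_def)
  have AN: "A dvd int N" unfolding N(2) A_def by (rule dvd_power_diff_mono[OF c(2)])
  have KA: "2 ^ j dvd A" if "2 ^ j dvd K" for j :: nat
  proof -
    define T where "T = qsum (u ^ c) (v ^ c) n'"
    have "K = A * T" unfolding K_def A_def T_def qsum_mult by (simp add: n' power_mult)
    moreover have "odd T"
      unfolding T_def using dvd_qsum_iff[of 2 "u ^ c" "v ^ c" n'] evA n'(2) odd_u by (simp add: A_def)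
    hence "coprime (2 ^ j) T" by simp
    ultimately show ?thesis using that by (simp add: coprime_dvd_mult_left_iff)
  qed
  obtain e w where ew: "N = 2 ^ e * w" "odd w"
    using multiplicity_decompose'[of N 2] N(1) by (metis less_not_refl odd_one)
  have "even N" using AN evA by (metis dvd_trans even_of_nat)
  then obtain f where f: "e = Suc f" using ew by (cases e) auto
  have tN: "totient N = 2 ^ f * totient w"
    using ew f by (simp add: totient_mult_coprime totient_prime_power_Suc del: power_Suc)
  have tK: "int (totient N) dvd K" using dvd by (simp add: N_def K_def)
  have tle: "int (totient N) \<le> K" using zdvd_imp_le[OF tK K] .
  have no: "\<not> 2 ^ Suc e dvd int N"
  proof
    assume "2 ^ Suc e dvd int N"
    hence "int (2 ^ e * 2) dvd int (2 ^ e * w)" by (simp add: ew mult.commute)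
    hence "2 ^ e * 2 dvd 2 ^ e * w" by (simp only: int_dvd_int_iff)
    thus False using ew(2) by simp
  qed
  have pow: "2 ^ (f + i) dvd A" if "2 ^ i dvd totient w" for i :: nat
  proof -
    have "2 ^ (f + i) dvd totient N" unfolding tN power_add using that by (intro mult_dvd_mono) auto
    hence "int (2 ^ (f + i)) dvd int (totient N)" by (simp only: int_dvd_int_iff)
    hence "2 ^ (f + i) dvd int (totient N)" by simp
    thus ?thesis using tK KA dvd_trans by blast
  qed
  \<comment> \<open>Now (u^c + v^c) A divides N, so N has one more factor 2 than A; this makes
    phi(w) odd, hence w = 1.\<close>
  have caseA: "N = 2 ^ e \<and> int N \<le> 2 * K" if "2 * c dvd m"
  proof -
    have "2 * A dvd int N"
    proof -
      have "2 * A dvd (u ^ c + v ^ c) * A" using odd_u odd_v by (intro mult_dvd_mono) auto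
      also have "(u ^ c + v ^ c) * A = u ^ (2 * c) - v ^ (2 * c)"
        unfolding mult_2 power_add by (simp add: A_def algebra_simps)
      also have "\<dots> dvd int N" unfolding N(2) by (rule dvd_power_diff_mono[OF that])
      finally show ?thesis .
    qed
    have "odd (totient w)"
    proof
      assume "even (totient w)"
      hence "2 ^ e dvd A" using pow[of 1] by (simp add: f)
      hence "2 ^ Suc e dvd 2 * A" by simp
      thus False using \<open>2 * A dvd int N\<close> no dvd_trans by blast
    qed
    from odd_totient_imp_le_2[OF this] have "w = 1" using ew(2) by presburger
    hence "N = 2 ^ e" "2 * totient N = N" using ew tN f by auto
    thus ?thesis using tle by linarith
  qed
  have caseB: "int N \<le> 3 * K" if "\<not> 2 * c dvd m"
  proof -
    have "\<not> 4 dvd totient w"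
    proof
      assume "4 dvd totient w"
      hence "2 ^ Suc e dvd A" using pow[of 2] by (simp add: f)
      thus False using no AN dvd_trans by blast
    qed
    from three_totient_ge[OF ew(2) this] have "2 ^ f * (2 * w) \<le> 2 ^ f * (3 * totient w)"
      by (rule mult_le_mono2)
    moreover have "2 ^ f * (2 * w) = N" by (simp add: ew f)
    moreover have "2 ^ f * (3 * totient w) = 3 * totient N" by (simp only: tN mult_ac)
    ultimately have "N \<le> 3 * totient N" by simp
    thus ?thesis using tle by linarith
  qed
  have le3: "int N \<le> 3 * K" using caseA caseB K by (cases "2 * c dvd m") auto
  define b where "b = \<bar>v\<bar>"
  have b: "0 < b" "b < u" using v_ne less by (auto simp: b_def)
  \<comment> \<open>If v could be replaced by |v| in both powers, N > u K >= 3 K would follow. So v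
    < 0, and n is odd, because an even n makes c and hence m even.\<close>
  have "\<not> (v ^ n = b ^ n \<and> v ^ m = b ^ m)"
  proof
    assume eq: "v ^ n = b ^ n \<and> v ^ m = b ^ m"
    have "3 * K \<le> u * K" using u_ge K by (intro mult_right_mono) auto
    also have "\<dots> < int N"
      unfolding K_def N(2) using mult_power_diff_less[OF b mn(1,2)] eq by simp
    finally show False using le3 by simp
  qed
  moreover have "even m" if "even n"
  proof -
    have "even c" using that n' by simp
    thus ?thesis using c(2) dvd_trans by blast
  qed
  ultimately have vb: "v = - b" "odd n" by (auto simp: b_def power_even_abs abs_if split: if_splits)
  have "c = 1" using vb(2) unfolding c_def by (simp add: not_dvd_imp_multiplicity_0)
  have Kb: "K = u ^ n + b ^ n" using vb by (simp add: K_def)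
  have "even m"
  proof (rule ccontr)
    assume "odd m"
    hence "m \<ge> n + 2" using mn(2) vb(2) by presburger
    hence "u ^ (n + 2) \<le> u ^ m" using u_ge by (intro power_increasing) auto
    moreover have "9 * u ^ n \<le> u ^ (n + 2)"
      unfolding power_add mult.commute[of "u ^ n"] using power_mono[of 3 u 2] u_ge by (intro mult_right_mono) auto
    moreover have "int N = u ^ m + b ^ m" using N(2) vb \<open>odd m\<close> by simp
    moreover have "b ^ n < u ^ n" "b ^ m > 0" "u ^ n > 0" using b mn by (auto intro: power_strict_mono)
    ultimately show False using le3 Kb by linarith
  qed
  hence two: "N = 2 ^ e" "int N \<le> 2 * K" using caseA \<open>c = 1\<close> by auto
  have Nb: "int N = u ^ m - b ^ m" using N(2) vb \<open>even m\<close> by simp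
  have m2: "2 \<le> m" using mn by simp
  have "even (u - b)" using odd_u odd_v vb by simp
  hence ub: "2 \<le> u - b" using b by presburger
  \<comment> \<open>The chain 2 K <= (u - b) (u^(m-1) + b^(m-1)) <= N <= 2 K closes up, and the
    equality case of \<open>mult_power_sum_le\<close> gives m = 2.\<close>
  have "u ^ n + b ^ n \<le> u ^ (m - 1) + b ^ (m - 1)"
    using b mn by (intro add_mono power_increasing) auto
  hence "2 * K \<le> 2 * (u ^ (m - 1) + b ^ (m - 1))" by (simp add: Kb)
  also have "\<dots> \<le> (u - b) * (u ^ (m - 1) + b ^ (m - 1))"
    using ub b by (intro mult_right_mono add_nonneg_nonneg) auto
  finally have ge: "2 * K \<le> (u - b) * (u ^ (m - 1) + b ^ (m - 1))" .
  have "m = 2" using mult_power_sum_le[OF b m2] ge two(2) Nb by linarith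
  hence "n = 1" using mn by simp
  have "(u - b) * (u + b) \<le> 2 * (u + b)"
    using two(2) Nb Kb \<open>m = 2\<close> \<open>n = 1\<close> by (simp add: power2_eq_square algebra_simps)
  hence "u - b \<le> 2" by (rule mult_right_le_imp_le) (use b in simp)
  hence "u - b = 2" using ub by simp
  have "2 * (u + b) = 2 * 2 ^ f"
  proof -
    have "2 * (u + b) = (u - b) * (u + b)" by (simp add: \<open>u - b = 2\<close>)
    also have "\<dots> = int N" by (simp add: Nb \<open>m = 2\<close> power2_eq_square algebra_simps)
    finally show ?thesis by (simp add: two(1) f)
  qed
  hence "u - v = 2 ^ f" using vb by simp
  thus ?thesis using \<open>m = 2\<close> \<open>n = 1\<close> \<open>u - b = 2\<close> vb by auto
qed

text \<open>Otherwise, with g = gcd(m, n), the quotient n / g is even and m / g is odd, and u^g, v^g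
  would form an instance of the contradictory \<open>residual_case\<close>.\<close>

lemma two_power_dvd_of_totient_dvd:
  fixes m n :: nat
  assumes mn: "0 < n" "n < m"
    and dvd: "int (totient (nat (u ^ m - v ^ m))) dvd u ^ n - v ^ n"
  shows "2 ^ multiplicity 2 n dvd m"
proof (rule ccontr)
  assume nd: "\<not> 2 ^ multiplicity 2 n dvd m"
  define g where "g = gcd m n"
  have g: "g > 0" using mn by (simp add: g_def)
  define m' n' where "m' = m div g" and "n' = n div g"
  have eq: "m = g * m'" "n = g * n'" by (simp_all add: m'_def n'_def g_def)
  have cop': "coprime m' n'" unfolding m'_def n'_def g_def using mn by (intro div_gcd_coprime) auto
  have "even n'"
  proof (rule ccontr)
    assume "odd n'"
    hence "coprime (2 ^ multiplicity 2 n) n'" by simp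
    moreover have "2 ^ multiplicity 2 n dvd g * n'" using eq(2) multiplicity_dvd[of 2 n] by simp
    ultimately have "2 ^ multiplicity 2 n dvd g" by (simp add: coprime_dvd_mult_left_iff)
    thus False using nd eq(1) by (metis dvd_mult2)
  qed
  hence "odd m'" using cop' by (metis coprime_common_divisor_nat odd_one one_dvd dvd_refl even_numeral numeral_eq_one_iff semiring_norm(85))
  have pw: "(u ^ g) ^ m' = u ^ m" "(v ^ g) ^ m' = v ^ m" "(u ^ g) ^ n' = u ^ n" "(v ^ g) ^ n' = v ^ n"
    by (simp_all add: eq power_mult)
  have "residual_case (u ^ g) (v ^ g) m' n'"
  proof
    show "coprime (u ^ g) (v ^ g)" using cop by simp
    show "odd (u ^ g)" "odd (v ^ g)" using odd_u odd_v by auto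
    show "\<bar>v ^ g\<bar> < u ^ g" by (rule abs_power_less[OF g])
    show "0 < n'" "n' < m'" using mn eq by auto
    show "int (totient (nat ((u ^ g) ^ m' - (v ^ g) ^ m'))) dvd (u ^ g) ^ n' - (v ^ g) ^ n'"
      unfolding pw by (rule dvd)
  qed fact+
  thus False by (rule residual_case.inconsistent)
qed

end

section \<open>From arbitrary solutions to coprime odd bases\<close>

lemma power_diff_eq_1:
  fixes x y :: int
  assumes "\<bar>y\<bar> < x" "y \<noteq> 0" "0 < m" "x ^ m - y ^ m = 1"
  shows "x = y + 1" "0 < y" "m = 1"
proof -
  have "x - y dvd 1" using dvd_power_diff_mono[of 1 m x y] assms(4) by simp
  hence "x - y \<le> 1" by (rule zdvd_imp_le) simp
  thus x: "x = y + 1" using assms(1) by linarith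
  thus y: "0 < y" using assms(1,2) by linarith
  show "m = 1"
  proof (rule ccontr)
    assume "m \<noteq> 1"
    hence "x * (x ^ 1 - y ^ 1) < x ^ m - y ^ m"
      using y x assms(3) by (intro mult_power_diff_less) auto
    thus False using assms(4) x y by simp
  qed
qed

text \<open>The sign of y^n may vary with parity, so the left side is bounded by x^m + |y|^m and the
  right side from below by x^n - |y|^n; \<open>mult_power_sum_le\<close> connects the two.\<close>

lemma power_diff_mono_exponent:
  fixes x y :: int
  assumes "\<bar>y\<bar> < x" "y \<noteq> 0" "0 < m" "m \<le> n"
  shows "x ^ m - y ^ m \<le> x ^ n - y ^ n"
proof (cases "m = n")
  case False
  hence mn: "m < n" "2 \<le> n" using assms by auto
  define b where "b = \<bar>y\<bar>"
  have b: "0 < b" "b < x" using assms by (auto simp: b_def)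
  have "x ^ m - y ^ m \<le> x ^ m + b ^ m"
    unfolding b_def by (simp flip: power_abs)
  also have "\<dots> \<le> 1 * (x ^ (n - 1) + b ^ (n - 1))"
    using b mn by (auto intro!: add_mono power_increasing)
  also have "\<dots> \<le> (x - b) * (x ^ (n - 1) + b ^ (n - 1))"
    using b by (intro mult_right_mono add_nonneg_nonneg) auto
  also have "\<dots> \<le> x ^ n - b ^ n" by (rule mult_power_sum_le(1)[OF b mn(2)])
  also have "\<dots> \<le> x ^ n - y ^ n" unfolding b_def by (simp flip: power_abs)
  finally show ?thesis .
qed simp

lemma totient_solution_normalized:
  fixes x y :: int
  assumes xy: "\<bar>y\<bar> < x" "y \<noteq> 0" and mn: "0 < m" "0 < n"
    and sol: "int (totient (nat (x ^ m - y ^ m))) = x ^ n - y ^ n"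
  shows "(x = y + 1 \<and> m = 1 \<and> n = 1) \<or>
    (\<exists>t::nat. t \<ge> 2 \<and> x = 2 ^ (t - 1) + 1 \<and> y = - (2 ^ (t - 1) - 1) \<and> m = 2 \<and> n = 1)"
proof (cases "m \<le> n")
  case True
  have pos: "0 < x ^ j - y ^ j" if "0 < j" for j
    using power_strict_mono[OF xy(1), of j] that abs_ge_self[of "y ^ j"] by (simp add: power_abs)
  define N where "N = nat (x ^ m - y ^ m)"
  have N: "int N = x ^ m - y ^ m" "N > 0" using pos[OF mn(1)] by (auto simp: N_def)
  have "int N \<le> int (totient N)"
    using power_diff_mono_exponent[OF xy mn(1) True] sol by (simp add: N(1) flip: N_def)
  hence N1: "N = 1" using totient_less[of N] N(2) by (cases "N = 1") auto
  hence 1: "x ^ m - y ^ m = 1" "x ^ n - y ^ n = 1" using N sol by (simp_all flip: N_def)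
  show ?thesis using power_diff_eq_1[OF xy mn(1) 1(1)] power_diff_eq_1[OF xy mn(2) 1(2)] by simp
next
  case False
  hence nm: "n < m" by simp
  define d where "d = gcd x y"
  have d: "d > 0" using xy by (auto simp: d_def)
  define u v where "u = x div d" and "v = y div d"
  have xd: "x = d * u" "y = d * v" by (simp_all add: u_def v_def d_def)
  have cop: "coprime u v" unfolding u_def v_def d_def using xy by (intro div_gcd_coprime) auto
  have "\<bar>v\<bar> * d < u * d" using xy(1) d by (simp add: xd abs_mult mult.commute)
  hence uv: "\<bar>v\<bar> < u" "v \<noteq> 0" using d xy(2) xd by auto
  have pos: "0 < u ^ j - v ^ j" if "0 < j" for j
    using power_strict_mono[OF uv(1), of j] that abs_ge_self[of "v ^ j"] by (simp add: power_abs)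
  define N where "N = nat (u ^ m - v ^ m)"
  have N: "int N = u ^ m - v ^ m" "N > 0" using pos[OF mn(1)] by (auto simp: N_def)
  define K where "K = u ^ n - v ^ n"
  define D where "D = nat d"
  have D: "int D = d" "D > 0" using d by (auto simp: D_def)
  \<comment> \<open>Here k = m - n - 1 is the exponent of d that survives: phi(d^m N) = d^(m-1)
    phi(d N) is equated with d^n K.\<close>
  obtain k where k: "m = Suc (n + k)" using nm less_imp_Suc_add by blast
  have "x ^ m - y ^ m = int (D ^ Suc (n + k) * N)"
    unfolding k[symmetric] by (simp add: D N xd power_mult_distrib right_diff_distrib)
  hence "nat (x ^ m - y ^ m) = D ^ Suc (n + k) * N" by (simp only: nat_int)
  hence "int (totient (nat (x ^ m - y ^ m))) = int (D ^ (n + k) * totient (D * N))"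
    by (simp only: totient_power_mult)
  also have "\<dots> = d ^ n * (d ^ k * int (totient (D * N)))" by (simp add: D power_add)
  finally have "d ^ n * (d ^ k * int (totient (D * N))) = d ^ n * K"
    using sol by (simp add: K_def xd power_mult_distrib right_diff_distrib)
  hence KD: "d ^ k * int (totient (D * N)) = K" using d by simp
  have "int (totient N) dvd int (totient (D * N))" by (simp add: Totient.totient_dvd)
  hence dvd: "int (totient N) dvd K" unfolding KD[symmetric] by simp
  \<comment> \<open>Bases of different parity make N and K odd. An odd totient then forces N = 1 and
    so m = 1, against n < m.\<close>
  have odd: "odd u \<and> odd v"
  proof (rule ccontr)
    assume a: "\<not> (odd u \<and> odd v)"
    have "\<not> (even u \<and> even v)" using cop by (metis coprime_common_divisor odd_one)
    hence oN: "odd (u ^ m - v ^ m)" "odd K" using a mn by (auto simp: K_def)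
    hence "odd (totient N)" using dvd dvd_trans even_of_nat by blast
    from odd_totient_imp_le_2[OF this] have "N \<le> 2" .
    moreover have "odd N" using oN(1) by (simp flip: N(1))
    ultimately have "N = 1" using N(2) by presburger
    hence "m = 1" using power_diff_eq_1(3)[OF uv mn(1)] N(1) by simp
    thus False using nm mn by simp
  qed
  interpret odd_pair u v using cop odd uv by unfold_locales auto
  have dvd': "int (totient (nat (u ^ m - v ^ m))) dvd u ^ n - v ^ n" using dvd by (simp add: N_def K_def)
  from exponents_of_totient_dvd[OF mn(2) nm two_power_dvd_of_totient_dvd[OF mn(2) nm dvd'] dvd']
  obtain e where e: "m = 2" "n = 1" "u + v = 2" "u - v = 2 ^ e" by blast
  have "int N = (u + v) * (u - v)" by (simp add: N(1) e(1) power2_eq_square algebra_simps)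
  hence "int N = int (2 ^ Suc e)" by (simp add: e)
  hence Ne: "N = 2 ^ Suc e" by (simp only: of_nat_eq_iff)
  hence tN: "totient N = 2 ^ e" by (simp add: totient_prime_power_Suc del: power_Suc)
  \<comment> \<open>With m = 2 and n = 1 no power of d remains, so phi(d N) = phi(N) with N even,
    which leaves only d = 1.\<close>
  have "k = 0" using k e by simp
  hence "int (totient (D * N)) = int (totient N)" using KD tN e by (simp add: K_def)
  hence "totient (D * N) = totient N" by simp
  moreover have "even N" by (simp add: Ne)
  ultimately have "D = 1" using N(2) D(2) by (intro totient_mult_eq_imp_1[of D N]) auto
  hence xuv: "x = u" "y = v" using D xd by auto
  have "v < 0" using e(3) u_ge by simp
  hence "4 \<le> u - v" by (rule diff_ge(2))
  \<comment> \<open>The bound u - v >= 4 gives e >= 2, so e itself serves as the parameter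
    t.\<close>
  then obtain s where s: "e = Suc (Suc s)"
    unfolding e(4) by (cases e; cases "e - 1") auto
  have "2 * u = 2 * (2 ^ Suc s + 1)" using e(3,4) by (simp add: s)
  hence u: "u = 2 ^ Suc s + 1" by simp
  hence "v = - (2 ^ Suc s - 1)" using e(3) by simp
  thus ?thesis using u xuv e(1,2) by (intro disjI2 exI[of _ "Suc (Suc s)"]) auto
qed

text \<open>Covers |x| = |y|, which the normalization |y| < x misses. Both exponents must be odd,
  and with z = |x| the equation is phi(2 z^m) = 2 z^n. This forces z > 1 and m >= n + 2; cancelling
  z^n leaves z^(m-n-1) phi(2 z) = 2, so z = 2, where the left side is at least 4.\<close>

lemma no_antipodal_solution: "\<not> totient_solution x (- x) m n"
proof
  assume "totient_solution x (- x) m n"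
  hence x: "x \<noteq> 0" and mn: "m > 0" "n > 0" and ne: "x ^ m \<noteq> (- x) ^ m"
    and sol: "int (totient (nat \<bar>x ^ m - (- x) ^ m\<bar>)) = \<bar>x ^ n - (- x) ^ n\<bar>"
    by (auto simp: totient_solution_def)
  have odd_m: "odd m" using ne by auto
  have odd_n: "odd n"
  proof (rule ccontr)
    assume "\<not> odd n"
    hence "totient (nat \<bar>x ^ m - (- x) ^ m\<bar>) = 0" using sol by simp
    thus False using ne by simp
  qed
  define z where "z = nat \<bar>x\<bar>"
  have z: "z > 0" "\<bar>x\<bar> = int z" using x by (auto simp: z_def)
  have ab: "\<bar>x ^ j - (- x) ^ j\<bar> = int (z ^ j * 2)" if "odd j" for j
    using that z(2) by (simp add: power_abs abs_mult flip: mult_2)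
  have eq: "totient (z ^ m * 2) = z ^ n * 2"
    using sol unfolding ab[OF odd_m] ab[OF odd_n] nat_int of_nat_eq_iff .
  have "totient (z ^ m * 2) < z ^ m * 2" using z(1) by (intro totient_less) (simp add: Suc_lessI)
  hence "z ^ n < z ^ m" using eq by simp
  hence "z > 1" "n < m" using z(1) by (metis nat_neq_iff power_one less_one not_less_zero) (metis \<open>z ^ n < z ^ m\<close> not_less power_increasing One_nat_def Suc_leI z(1) leD)
  hence "n + 2 \<le> m" using odd_m odd_n by presburger
  then obtain j where j: "m = Suc (n + Suc j)" by (metis add_2_eq_Suc' add_Suc_right add_Suc le_Suc_ex)
  have "z ^ (n + Suc j) * totient (z * 2) = z ^ n * 2" using eq unfolding j totient_power_mult .
  hence zt: "z ^ Suc j * totient (z * 2) = 2" using z(1) by (simp add: power_add)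
  hence "z dvd 2" by (metis dvd_mult2 dvd_triv_left power_Suc)
  hence "z = 2" using \<open>z > 1\<close> by (auto dest: dvd_imp_le)
  thus False using zt by simp
qed

theorem theorem1p1:
  fixes x y :: int and m n :: nat
  assumes "totient_solution x y m n"
    and "\<not> trivial_solution x y m n"
  shows "\<exists>t::nat. t \<ge> 2 \<and>
    ((x, y, m, n) = (2 ^ (t - 1) + 1, - (2 ^ (t - 1) - 1), 2, 1) \<or>
     (x, y, m, n) = (2 ^ (t - 1) - 1, - (2 ^ (t - 1) + 1), 2, 1) \<or>
     (x, y, m, n) = (- (2 ^ (t - 1) + 1), 2 ^ (t - 1) - 1, 2, 1) \<or>
     (x, y, m, n) = (- (2 ^ (t - 1) - 1), 2 ^ (t - 1) + 1, 2, 1))"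
proof -
  have norm: "(a = b + 1 \<and> m = 1 \<and> n = 1) \<or>
      (\<exists>t::nat. t \<ge> 2 \<and> a = 2 ^ (t - 1) + 1 \<and> b = - (2 ^ (t - 1) - 1) \<and> m = 2 \<and> n = 1)"
    if "totient_solution a b m n" "\<bar>b\<bar> < a" for a b
  proof -
    have pos: "0 < a ^ j - b ^ j" if "0 < j" for j
      using power_strict_mono[OF \<open>\<bar>b\<bar> < a\<close>, of j] that abs_ge_self[of "b ^ j"] by (simp add: power_abs)
    show ?thesis
      using that pos[of m] pos[of n] by (intro totient_solution_normalized) (auto simp: totient_solution_def)
  qed
  have swap: "totient_solution b a m n" if "totient_solution a b m n" for a b
    using that by (auto simp: totient_solution_def abs_minus_commute mult.commute)
  have neg: "totient_solution (- a) (- b) m n" if "totient_solution a b m n" for a b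
  proof -
    have "\<bar>(- a) ^ j - (- b) ^ j\<bar> = \<bar>a ^ j - b ^ j\<bar>" for j
      by (cases "even j") (auto simp: abs_minus_commute)
    moreover have "(- a) ^ m \<noteq> (- b) ^ m" using that
      by (cases "even m") (auto simp: totient_solution_def)
    ultimately show ?thesis using that by (simp add: totient_solution_def)
  qed
  have nt: "\<not> ((x = y + 1 \<or> y = x + 1) \<and> m = 1 \<and> n = 1)"
    using assms(2) by (auto simp: trivial_solution_def)
  have "x \<noteq> y" using assms(1) by (auto simp: totient_solution_def)
  moreover have "y \<noteq> - x" using no_antipodal_solution assms(1) by blast
  \<comment> \<open>Once |x| = |y| is excluded, exactly one of the pairs obtained from (x, y) by
    swapping and negating has first entry larger than the absolute value of the second.\<close>
  ultimately consider "\<bar>y\<bar> < x" | "\<bar>x\<bar> < y" | "\<bar>- y\<bar> < - x" | "\<bar>- x\<bar> < - y" by linarith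
  thus ?thesis
  proof cases
    case 1 from norm[OF assms(1) this] nt show ?thesis by auto
  next
    case 2 from norm[OF swap[OF assms(1)] this] nt show ?thesis by auto
  next
    case 3 from norm[OF neg[OF assms(1)] this] nt show ?thesis by auto
  next
    case 4 from norm[OF swap[OF neg[OF assms(1)]] this] nt show ?thesis by auto
  qed
qed

end
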